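(* Let $k_0$ be a fragmentation kernel. Then the equation $$\partial_tu(t,x)+u(t,x)=\int_x^\infty\frac1yk_0\left(\frac xy\right)u(t,y)\,dy$$ has no solution of the form $$\omega(t,x)=f(t)\,\Phi(x\,g(t)),$$ where $f$ and $g$ are continuously differentiable functions from $\mathbb R^+$ to itself and $\Phi\in L^1((1+x)dx)$.
   Context: A fragmentation kernel is a nonnegative bounded measure $k_0$ (written $k_0(z)dz$) with support contained in $[0,1]$ such that $\int_0^1 z\,k_0(z)dz=1$ and $\int_0^1k_0(z)dz>1$. In the equation $t>0$, $x>0$, and for a measure $k_0$ the right-hand side means $\int u(t,x/z)\,z^{-1}k_0(dz)$.
   Formalization: "No solution" is read as no nonzero solution (Φ = 0 always gives one), and the integrals of k_0 run over (0,1], which excludes only k_0 = δ_1 + aδ_0, where the right-hand side is undefined at z = 0 (if that atom is ignored, stationary solutions exist). *)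

theory Defs
  imports "HOL-Analysis.Analysis"
begin

text \<open>
  A bounded nonnegative measure on the line, supported in \<open>[0,1]\<close>.  The integrals from \<open>0\<close> to \<open>1\<close>
  run over \<open>(0,1]\<close>: the gain term \<open>u(t,x/z)/z\<close> has no meaning at \<open>z = 0\<close>, and an atom there
  must not count towards \<open>k0((0,1]) > 1\<close> (\<open>\<delta>\<^sub>0 + \<delta>\<^sub>1\<close> would reduce the equation to
  \<open>\<partial>\<^sub>t u = 0\<close>, for which every stationary profile is a solution).  An atom at \<open>1\<close> is allowed.
\<close>

definition fragmentation_kernel :: "real measure \<Rightarrow> bool" where
  "fragmentation_kernel k0 \<longleftrightarrow>
     finite_measure k0 \<and> sets k0 = sets borel \<and>
     emeasure k0 (- {0..1}) = 0 \<and>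
     (LINT z:{0<..1}|k0. z) = 1 \<and>
     measure k0 {0<..1} > 1"

text \<open>
  For \<open>k0\<close> with a density and \<open>x > 0\<close>, the substitution \<open>z = x/y\<close> turns this into the integral
  of \<open>k0(x/y) u(t,y) / y\<close> over \<open>y\<close> from \<open>x\<close> to infinity.
\<close>

definition frag_gain :: "real measure \<Rightarrow> (real \<Rightarrow> real \<Rightarrow> real) \<Rightarrow> real \<Rightarrow> real \<Rightarrow> real" where
  "frag_gain k0 u t x = (LINT z:{0<..1}|k0. u t (x / z) / z)"

definition quadrant :: "(real \<times> real) set" where
  "quadrant = {0<..} \<times> {0<..}"

definition locally_integrable_on :: "(real \<times> real \<Rightarrow> real) \<Rightarrow> (real \<times> real) set \<Rightarrow> bool" where
  "locally_integrable_on F S \<longleftrightarrow> (\<forall>K. compact K \<and> K \<subseteq> S \<longrightarrow> set_integrable lborel K F)"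

definition C1_test_function_on :: "(real \<times> real \<Rightarrow> real) \<Rightarrow> (real \<times> real) set \<Rightarrow> bool" where
  "C1_test_function_on \<phi> S \<longleftrightarrow>
     (\<exists>K. compact K \<and> K \<subseteq> S \<and> (\<forall>p. p \<notin> K \<longrightarrow> \<phi> p = 0)) \<and>
     (\<exists>D :: real \<times> real \<Rightarrow> (real \<times> real) \<Rightarrow>\<^sub>L real.
        (\<forall>p. (\<phi> has_derivative blinfun_apply (D p)) (at p)) \<and> continuous_on UNIV D)"

text \<open>
  Solutions of \<open>\<partial>\<^sub>t u + u = frag_gain k0 u\<close> in \<open>t > 0\<close>, \<open>x > 0\<close>, in the weak sense, since for
  \<open>u(t,x) = f(t) \<Phi>(x g(t))\<close> with \<open>\<Phi>\<close> merely in \<open>L\<^sup>1\<close> the time derivative exists only as a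
  distribution.  The last conjunct is the equation multiplied by \<open>\<phi>\<close> and integrated by
  parts in \<open>t\<close>; the others make both of its sides meaningful.  For such \<open>u\<close>, solutions in the
  classical sense or in an \<open>L\<^sup>1\<close>-valued sense are solutions in this sense.
\<close>

definition frag_solution :: "real measure \<Rightarrow> (real \<Rightarrow> real \<Rightarrow> real) \<Rightarrow> bool" where
  "frag_solution k0 u \<longleftrightarrow>
     locally_integrable_on (\<lambda>(t, x). u t x) quadrant \<and>
     (AE (t, x) in lborel. (t, x) \<in> quadrant \<longrightarrow>
        set_integrable k0 {0<..1} (\<lambda>z. u t (x / z) / z)) \<and>
     locally_integrable_on (\<lambda>(t, x). frag_gain k0 u t x) quadrant \<and>
     (\<forall>\<phi>. C1_test_function_on \<phi> quadrant \<longrightarrow>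
        (LINT (t, x):quadrant|lborel. u t x * (\<phi> (t, x) - deriv (\<lambda>s. \<phi> (s, x)) t)) =
        (LINT (t, x):quadrant|lborel. frag_gain k0 u t x * \<phi> (t, x)))"

end

theory Submission
  imports Defs "HOL-Probability.Levy" "HOL-Complex_Analysis.Conformal_Mappings"
begin

text \<open>
  Write \<open>M(s) = \<integral> y\<^sup>s \<Phi>(y) dy\<close> for the Mellin transform of the profile on the half-line and
  \<open>K(s) = \<integral> z\<^sup>s k0(dz)\<close>, over \<open>(0,1]\<close>, for the moments of the kernel, where \<open>0 \<le> s \<le> 1\<close>.  The
  Mellin transform in \<open>x\<close> of \<open>f(t) \<Phi>(x g(t))\<close> is \<open>f(t) g(t) powr (- s - 1) M(s)\<close>, and it turns the
  gain term into multiplication by \<open>K(s)\<close> (lemma \<open>fragment_profile\<close>).  The equation therefore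
  becomes a scalar differential equation for each \<open>s\<close>; where \<open>M(s) \<noteq> 0\<close> it reads

    \<open>f'/f - (s + 1) g'/g = K(s) - 1\<close>.

  At a fixed time the left side is affine in \<open>s\<close>, so \<open>K\<close> agrees with an affine function wherever
  \<open>M\<close> does not vanish (lemma \<open>moment_affine_of_self_similar\<close>).

  On the other hand \<open>K\<close> is strictly convex: each \<open>z\<^sup>s\<close> with \<open>0 < z < 1\<close> is, and \<open>k0\<close> restricted to
  \<open>(0,1]\<close> is not concentrated at \<open>z = 1\<close>, because \<open>\<integral> z k0(dz) = 1 < k0 (0,1]\<close>.  Hence \<open>K\<close> is not affine
  on any three distinct points (lemma \<open>kernel_moment_not_affine\<close>).

  It remains to find three points with \<open>M(s) \<noteq> 0\<close>.  The function \<open>M\<close> extends holomorphically to the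
  strip \<open>0 < Re w < 1\<close>.  If it vanished on some interval inside \<open>(0,1)\<close>, it would vanish on the
  whole strip, and uniqueness of Fourier transforms on the line \<open>Re w = 1/2\<close> would give \<open>\<Phi> = 0\<close> almost
  everywhere (theorem \<open>mellin_uniqueness\<close>).

  Because \<open>\<Phi>\<close> may change sign, any prescribed moment, the total mass included, can vanish; this is
  why the exponents have to be found by a uniqueness theorem.
\<close>

section \<open>Profiles and their Mellin transforms\<close>

text \<open>
  Functions on the half-line are extended by zero, so that integrals and dilations live on the whole
  line; the weight \<open>1 + y\<close> dominates \<open>y powr s\<close> exactly for \<open>0 \<le> s \<le> 1\<close>.
\<close>

definition profile :: "(real \<Rightarrow> real) \<Rightarrow> bool" where
  "profile \<Theta> \<longleftrightarrow> integrable lborel (\<lambda>y. (1 + y) * \<Theta> y) \<and> (\<forall>y\<le>0. \<Theta> y = 0)"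

definition mellin :: "(real \<Rightarrow> real) \<Rightarrow> real \<Rightarrow> real" where
  "mellin \<Theta> s = (LINT y|lborel. y powr s * \<Theta> y)"

lemma profile_nonpos: "profile \<Theta> \<Longrightarrow> y \<le> 0 \<Longrightarrow> \<Theta> y = 0"
  by (simp add: profile_def)

lemma profile_borel:
  assumes "profile \<Theta>"
  shows "\<Theta> \<in> borel_measurable borel"
proof -
  have [measurable]: "(\<lambda>y. (1 + y) * \<Theta> y) \<in> borel_measurable borel"
    using assms by (auto simp: profile_def dest: borel_measurable_integrable)
  have "\<Theta> = (\<lambda>y. if y \<le> 0 then 0 else ((1 + y) * \<Theta> y) / (1 + y))"
    using assms by (auto simp: profile_def fun_eq_iff)
  moreover have "(\<lambda>y. if y \<le> 0 then 0 else ((1 + y) * \<Theta> y) / (1 + y)) \<in> borel_measurable borel"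
    by measurable
  ultimately show ?thesis by simp
qed

lemma powr_le_one_plus:
  fixes y s :: real
  assumes "0 < y" "0 \<le> s" "s \<le> 1"
  shows "y powr s \<le> 1 + y"
proof (cases "y \<le> 1")
  case True
  have "y powr s \<le> 1" using assms True by (simp add: powr_le1)
  then show ?thesis using assms by simp
next
  case False
  have "y powr s \<le> y powr 1" using assms False by (intro powr_mono) auto
  then show ?thesis using assms by simp
qed

text \<open>
  Stated for weights in a general algebra so that it covers both the real powers \<open>y powr s\<close> and the
  complex terms of the power series of the transform.
\<close>

lemma profile_dominated_integrable:
  fixes k :: "real \<Rightarrow> 'b :: {banach, second_countable_topology, real_normed_algebra_1}"
  assumes "profile \<Theta>" and [measurable]: "k \<in> borel_measurable borel"
    and bound: "\<And>y. 0 < y \<Longrightarrow> norm (k y) \<le> C * (1 + y)"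
  shows "integrable lborel (\<lambda>y. k y * of_real (\<Theta> y))"
proof (rule Bochner_Integration.integrable_bound)
  show "integrable lborel (\<lambda>y. C * ((1 + y) * \<Theta> y))"
    using assms(1) by (simp add: profile_def)
  have [measurable]: "\<Theta> \<in> borel_measurable borel" by (rule profile_borel[OF assms(1)])
  show "(\<lambda>y. k y * of_real (\<Theta> y)) \<in> borel_measurable lborel"
    by measurable
  show "AE y in lborel. norm (k y * of_real (\<Theta> y)) \<le> norm (C * ((1 + y) * \<Theta> y))"
  proof (rule AE_I2)
    fix y :: real
    show "norm (k y * of_real (\<Theta> y)) \<le> norm (C * ((1 + y) * \<Theta> y))"
    proof (cases "0 < y")
      case True
      have "norm (k y * of_real (\<Theta> y)) \<le> norm (k y) * norm (of_real (\<Theta> y) :: 'b)"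
        by (rule norm_mult_ineq)
      also have "\<dots> = norm (k y) * \<bar>\<Theta> y\<bar>" by simp
      also have "\<dots> \<le> (C * (1 + y)) * \<bar>\<Theta> y\<bar>"
        using bound[OF True] by (rule mult_right_mono) simp
      also have "\<dots> \<le> norm (C * ((1 + y) * \<Theta> y))"
        using True by (simp add: abs_mult mult_right_mono mult.assoc)
      finally show ?thesis .
    qed (use assms(1) in \<open>simp add: profile_nonpos\<close>)
  qed
qed

lemma profile_powr_integrable:
  assumes "profile \<Theta>" "0 \<le> s" "s \<le> 1"
  shows "integrable lborel (\<lambda>y. y powr s * \<Theta> y)"
  using profile_dominated_integrable[OF assms(1), of "\<lambda>y. y powr s" 1] assms(2,3)
  by (simp add: powr_le_one_plus)

section \<open>Uniqueness for the Mellin transform\<close>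

definition strip :: "complex set" where "strip = {w. 0 < Re w \<and> Re w < 1}"

definition complex_mellin :: "(real \<Rightarrow> real) \<Rightarrow> complex \<Rightarrow> complex" where
  "complex_mellin \<Theta> w = (LINT y|lborel. exp (w * of_real (ln y)) * of_real (\<Theta> y))"

lemma complex_mellin_of_real:
  assumes "profile \<Theta>"
  shows "complex_mellin \<Theta> (of_real s) = of_real (mellin \<Theta> s)"
proof -
  have "exp (of_real s * of_real (ln y)) * of_real (\<Theta> y) = (of_real (y powr s * \<Theta> y) :: complex)" for y
    using profile_nonpos[OF assms, of y]
    by (cases "0 < y") (auto simp: powr_def exp_of_real simp flip: of_real_mult)
  then have "complex_mellin \<Theta> (of_real s) = (LINT y|lborel. of_real (y powr s * \<Theta> y))"
    by (simp only: complex_mellin_def)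
  also have "\<dots> = of_real (mellin \<Theta> s)"
    unfolding mellin_def by (rule integral_complex_of_real)
  finally show ?thesis .
qed

lemma exp_partial_sum_norm_le:
  fixes z :: complex
  shows "norm (\<Sum>n<N. z ^ n / fact n) \<le> exp (norm z)"
proof -
  have "norm (\<Sum>n<N. z ^ n / fact n) \<le> (\<Sum>n<N. norm z ^ n / fact n)"
    by (rule order_trans[OF norm_sum]) (simp add: norm_divide norm_power)
  also have "\<dots> \<le> (\<Sum>n. norm z ^ n / fact n)"
    using summable_exp[of "norm z"]
    by (intro sum_le_suminf) (auto simp: divide_inverse mult.commute)
  also have "\<dots> = exp (norm z)"
    by (simp add: exp_def divide_inverse mult.commute)
  finally show ?thesis .
qed

text \<open>
  Around a point \<open>c\<close> of the strip the integrand is expanded as \<open>y\<^sup>c \<Sum>\<^sub>n ((w - c) ln y)\<^sup>n / n!\<close>.  All partial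
  sums are bounded by \<open>y powr (Re c + r) + y powr (Re c - r)\<close> on the disc of radius \<open>r\<close> about \<open>c\<close>,
  and both exponents lie in \<open>[0,1]\<close> when the disc lies in the strip.  Dominated convergence then
  gives a power series for the transform.
\<close>

lemma complex_mellin_holomorphic:
  assumes "profile \<Theta>"
  shows "complex_mellin \<Theta> holomorphic_on strip"
proof -
  have [measurable]: "\<Theta> \<in> borel_measurable borel" by (rule profile_borel[OF assms(1)])
  have "complex_mellin \<Theta> holomorphic_on ball c (min (Re c) (1 - Re c))" if c: "c \<in> strip" for c
  proof -
    define r where "r = min (Re c) (1 - Re c)"
    define trm where "trm = (\<lambda>n y. exp (c * of_real (ln y)) * of_real (ln y) ^ n / fact n * of_real (\<Theta> y))"
    have exp_bound: "exp (Re c * ln y + \<rho> * \<bar>ln y\<bar>) \<le> 2 * (1 + y)"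
      if "0 < y" "0 \<le> \<rho>" "\<rho> \<le> r" for y \<rho>
    proof -
      have "exp (Re c * ln y + \<rho> * \<bar>ln y\<bar>) \<le> y powr (Re c + \<rho>) + y powr (Re c - \<rho>)"
        using \<open>0 < y\<close> by (cases "ln y \<ge> 0") (auto simp: powr_def algebra_simps)
      also have "\<dots> \<le> (1 + y) + (1 + y)"
        using that c by (intro add_mono powr_le_one_plus) (auto simp: r_def strip_def)
      finally show ?thesis by simp
    qed
    have partial_bound:
      "norm (exp (c * of_real (ln y)) * (\<Sum>n<N. (z * of_real (ln y)) ^ n / fact n)) \<le> 2 * (1 + y)"
      if y: "0 < y" and z: "norm z \<le> r" for y z N
    proof -
      have "norm (exp (c * of_real (ln y)) * (\<Sum>n<N. (z * of_real (ln y)) ^ n / fact n))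
          \<le> exp (Re c * ln y) * exp (norm (z * of_real (ln y)))"
        by (subst norm_mult, intro mult_mono exp_partial_sum_norm_le) (simp_all add: norm_exp_eq_Re)
      also have "\<dots> = exp (Re c * ln y + norm z * \<bar>ln y\<bar>)"
        by (simp add: exp_add norm_mult)
      also have "\<dots> \<le> 2 * (1 + y)"
        using y z by (intro exp_bound) auto
      finally show ?thesis .
    qed
    have r: "0 < r" using c by (simp add: r_def strip_def)
    have term_int: "integrable lborel (trm n)" for n
    proof -
      have "norm (exp (c * of_real (ln y)) * of_real (ln y) ^ n / fact n) \<le> (4 / r ^ n) * (1 + y)"
        if y: "0 < y" for y
      proof -
        \<comment> \<open>A single term is the difference of two partial sums evaluated at \<open>w - c = r\<close>,
          so it inherits their bound up to the factor \<open>r ^ n\<close>.\<close>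
        let ?S = "\<lambda>N. exp (c * of_real (ln y)) * (\<Sum>n<N. (of_real r * of_real (ln y)) ^ n / fact n)"
        have "exp (c * of_real (ln y)) * of_real (ln y) ^ n / fact n = (?S (Suc n) - ?S n) / of_real r ^ n"
          using r by (simp add: power_mult_distrib distrib_left)
        then have "norm (exp (c * of_real (ln y)) * of_real (ln y) ^ n / fact n) = norm ((?S (Suc n) - ?S n) / of_real r ^ n)"
          by (rule arg_cong)
        also have "\<dots> = norm (?S (Suc n) - ?S n) / r ^ n"
          using r by (simp only: norm_divide norm_power norm_of_real abs_of_pos)
        also have "norm (?S (Suc n) - ?S n) \<le> 2 * (1 + y) + 2 * (1 + y)"
          using y r by (intro norm_triangle_le_diff add_mono partial_bound) auto
        finally show ?thesis using r by (simp add: divide_right_mono)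
      qed
      then show ?thesis
        unfolding trm_def by (intro profile_dominated_integrable[OF assms, where C = "4 / r ^ n"]) auto
    qed
    have "(\<lambda>n. (LINT y|lborel. trm n y) * (w - c) ^ n) sums complex_mellin \<Theta> w" if w: "w \<in> ball c r" for w
    proof -
      let ?S = "\<lambda>N y. (exp (c * of_real (ln y)) * (\<Sum>n<N. ((w - c) * of_real (ln y)) ^ n / fact n)) * of_real (\<Theta> y)"
      have "(\<lambda>N. LINT y|lborel. ?S N y) \<longlonglongrightarrow> complex_mellin \<Theta> w"
        unfolding complex_mellin_def
      proof (rule integral_dominated_convergence[where w = "\<lambda>y. norm (2 * (1 + y) * \<Theta> y)"])
        show "integrable lborel (\<lambda>y. norm (2 * (1 + y) * \<Theta> y))"
          using assms by (intro integrable_norm, subst mult.assoc) (simp only: profile_def integrable_mult_right)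
        show "AE y in lborel. norm (?S N y) \<le> norm (2 * (1 + y) * \<Theta> y)" for N
        proof (rule AE_I2)
          fix y :: real
          show "norm (?S N y) \<le> norm (2 * (1 + y) * \<Theta> y)"
          proof (cases "0 < y")
            case True
            have "norm (?S N y) \<le> (2 * (1 + y)) * norm (of_real (\<Theta> y) :: complex)"
              unfolding norm_mult[of _ "of_real (\<Theta> y)"]
              using w True by (intro mult_right_mono partial_bound) (auto simp: dist_norm norm_minus_commute)
            then show ?thesis using True by (simp add: abs_mult)
          qed (simp add: profile_nonpos[OF assms])
        qed
        show "AE y in lborel. (\<lambda>N. ?S N y) \<longlonglongrightarrow> exp (w * of_real (ln y)) * of_real (\<Theta> y)"
        proof (rule AE_I2)
          fix y :: real
          have "(\<lambda>n. ((w - c) * of_real (ln y)) ^ n / fact n) sums exp ((w - c) * of_real (ln y))"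
            using exp_converges[of "(w - c) * of_real (ln y)"]
            by (simp add: scaleR_conv_of_real divide_inverse mult.commute)
          then have "(\<lambda>N. ?S N y) \<longlonglongrightarrow> (exp (c * of_real (ln y)) * exp ((w - c) * of_real (ln y))) * of_real (\<Theta> y)"
            unfolding sums_def by (intro tendsto_intros)
          then show "(\<lambda>N. ?S N y) \<longlonglongrightarrow> exp (w * of_real (ln y)) * of_real (\<Theta> y)"
            by (simp add: exp_add[symmetric] algebra_simps)
        qed
      qed measurable
      moreover have "(LINT y|lborel. ?S N y) = (\<Sum>n<N. (LINT y|lborel. trm n y) * (w - c) ^ n)" for N
      proof -
        have "?S N y = (\<Sum>n<N. trm n y * (w - c) ^ n)" for y
          unfolding trm_def sum_distrib_left sum_distrib_right power_mult_distrib
          by (rule sum.cong) (auto simp: mult_ac)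
        then have "(LINT y|lborel. ?S N y) = (LINT y|lborel. (\<Sum>n<N. trm n y * (w - c) ^ n))"
          by (simp only:)
        also have "\<dots> = (\<Sum>n<N. (LINT y|lborel. trm n y) * (w - c) ^ n)"
          using term_int by (subst Bochner_Integration.integral_sum) auto
        finally show ?thesis .
      qed
      ultimately show ?thesis by (simp add: sums_def)
    qed
    then show ?thesis unfolding r_def[symmetric] by (rule power_series_holomorphic)
  qed
  then have "complex_mellin \<Theta> holomorphic_on (\<Union>c\<in>strip. ball c (min (Re c) (1 - Re c)))"
    by (intro holomorphic_on_UN_open) auto
  then show ?thesis
    by (rule holomorphic_on_subset) (auto simp: strip_def)
qed

text \<open>
  In the variable \<open>ln x\<close> the hypothesis says that two finite measures have the same characteristic
  function, so Levy's uniqueness theorem applies after normalising the total mass, which is common to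
  both (case \<open>t = 0\<close>).  Pushing forward by \<open>exp\<close> returns to the original variable.
\<close>

lemma density_eq_from_fourier:
  fixes p q :: "real \<Rightarrow> real"
  assumes int: "integrable lborel p" "integrable lborel q"
    and nonneg: "\<And>x. 0 \<le> p x" "\<And>x. 0 \<le> q x" and supp: "\<And>x. x \<le> 0 \<Longrightarrow> p x = 0" "\<And>x. x \<le> 0 \<Longrightarrow> q x = 0"
    and eq: "\<And>t. (LINT x|lborel. exp (\<i> * of_real (t * ln x)) * of_real (p x)) =
                   (LINT x|lborel. exp (\<i> * of_real (t * ln x)) * of_real (q x))"
  shows "AE x in lborel. p x = q x"
proof -
  have [measurable]: "p \<in> borel_measurable borel" "q \<in> borel_measurable borel"
    using int by (auto dest: borel_measurable_integrable)
  define c where "c = (LINT x|lborel. p x)"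
  have "complex_of_real c = of_real (LINT x|lborel. q x)"
    using eq[of 0] by (simp add: c_def)
  then have c2: "c = (LINT x|lborel. q x)" by (simp only: of_real_eq_iff)
  have "0 \<le> c" unfolding c_def using nonneg by simp
  show ?thesis
  proof (cases "c = 0")
    case True
    have null: "AE x in lborel. h x = 0"
      if "integrable lborel h" "\<And>x. 0 \<le> h x" "(LINT x|lborel. h x) = 0" for h :: "real \<Rightarrow> real"
      using integral_nonneg_eq_0_iff_AE[OF that(1)] that(2,3) by simp
    have "AE x in lborel. p x = 0" "AE x in lborel. q x = 0"
      using null[OF int(1) nonneg(1)] null[OF int(2) nonneg(2)] True c2 by (simp_all only: c_def)
    then show ?thesis by eventually_elim simp
  next
    case False
    then have c: "0 < c" using \<open>0 \<le> c\<close> by simp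
    define law where "law = (\<lambda>p. distr (density lborel (\<lambda>x. ennreal (p x / c))) borel (ln :: real \<Rightarrow> real))"
    have law_rd: "real_distribution (law h)"
      and law_char: "char (law h) t = (LINT x|lborel. exp (\<i> * of_real (t * ln x)) * of_real (h x)) / of_real c"
      if h: "integrable lborel h" "\<And>x. 0 \<le> h x" "c = (LINT x|lborel. h x)" for h t
    proof -
      have [measurable]: "h \<in> borel_measurable borel"
        using h by (auto dest: borel_measurable_integrable)
      have "emeasure (density lborel (\<lambda>x. ennreal (h x / c))) UNIV = (\<integral>\<^sup>+x. ennreal (h x / c) \<partial>lborel)"
        by (subst emeasure_density) auto
      also have "\<dots> = ennreal (LINT x|lborel. h x / c)"
        using h c by (intro nn_integral_eq_integral) auto
      also have "\<dots> = 1" using h(3) c by simp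
      finally have "prob_space (density lborel (\<lambda>x. ennreal (h x / c)))"
        by (intro prob_spaceI) simp
      then show "real_distribution (law h)"
        unfolding law_def real_distribution_def real_distribution_axioms_def
        by (auto intro!: prob_space.prob_space_distr)
      have "char (law h) t = (LINT x|lborel. (h x / c) *\<^sub>R exp (\<i> * of_real (t * ln x)))"
      proof -
        have dens: "AE x in lborel. 0 \<le> h x / c" using h(2) c by simp
        have "char (law h) t = (LINT x|density lborel (\<lambda>x. ennreal (h x / c)). exp (\<i> * of_real (t * ln x)))"
          unfolding char_def law_def by (rule integral_distr) simp_all
        also have "\<dots> = (LINT x|lborel. (h x / c) *\<^sub>R exp (\<i> * of_real (t * ln x)))"
          by (rule integral_density[OF _ _ dens]) simp_all
        finally show ?thesis .
      qed
      also have "\<dots> = (LINT x|lborel. exp (\<i> * of_real (t * ln x)) * of_real (h x) / of_real c)"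
        by (intro Bochner_Integration.integral_cong) (auto simp: scaleR_conv_of_real)
      finally show "char (law h) t = (LINT x|lborel. exp (\<i> * of_real (t * ln x)) * of_real (h x)) / of_real c"
        by simp
    qed
    have "char (law p) = char (law q)"
      using law_char[OF int(1) nonneg(1) c_def] law_char[OF int(2) nonneg(2) c2] eq by (simp add: fun_eq_iff)
    then have law_eq: "law p = law q"
      using Levy_uniqueness law_rd[OF int(1) nonneg(1) c_def] law_rd[OF int(2) nonneg(2) c2] by blast
    have recover: "distr (law h) borel exp = density lborel (\<lambda>x. ennreal (h x / c))"
      if [measurable]: "h \<in> borel_measurable borel" and "\<And>x. x \<le> 0 \<Longrightarrow> h x = 0" for h
    proof -
      have "distr (law h) borel exp = distr (density lborel (\<lambda>x. ennreal (h x / c))) borel (exp \<circ> ln)"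
        unfolding law_def by (intro distr_distr) auto
      also have "\<dots> = distr (density lborel (\<lambda>x. ennreal (h x / c))) lborel (\<lambda>x. x)"
      proof (rule distr_cong_AE)
        show "AE x in density lborel (\<lambda>x. ennreal (h x / c)). (exp \<circ> ln) x = x"
        proof -
          have meas: "(\<lambda>x. ennreal (h x / c)) \<in> borel_measurable lborel"
            using that(1) by simp
          have "0 < ennreal (h x / c) \<longrightarrow> (exp \<circ> ln) x = x" for x
            using that(2)[of x] by (cases "0 < x") auto
          then show ?thesis unfolding AE_density[OF meas] by (intro AE_I2)
        qed
      qed auto
      also have "\<dots> = density lborel (\<lambda>x. ennreal (h x / c))"
        by (simp add: distr_id2)
      finally show ?thesis .
    qed
    have "density lborel (\<lambda>x. ennreal (p x / c)) = density lborel (\<lambda>x. ennreal (q x / c))"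
      using recover[of p] recover[of q] law_eq supp by simp
    then have "AE x in lborel. ennreal (p x / c) = ennreal (q x / c)"
      by (simp add: sigma_finite_measure.density_unique_iff[OF lborel.sigma_finite_measure_axioms])
    then show ?thesis
      by eventually_elim (use nonneg c in simp)
  qed
qed

text \<open>
  A real interval has limit points in the strip, so the holomorphic transform vanishes throughout it.
  On the line \<open>Re w = 1/2\<close> this is the vanishing of a Fourier transform, and splitting \<open>\<Theta>\<close> into
  positive and negative parts reduces the claim to equality of two positive densities.
\<close>

theorem mellin_uniqueness:
  assumes \<Theta>: "profile \<Theta>" and ab: "0 < a" "a < b" "b < 1"
    and zero: "\<And>s. a < s \<Longrightarrow> s < b \<Longrightarrow> mellin \<Theta> s = 0"
  shows "AE y in lborel. \<Theta> y = 0"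
proof -
  have [measurable]: "\<Theta> \<in> borel_measurable borel" by (rule profile_borel[OF assms(1)])
  have strip_zero: "complex_mellin \<Theta> w = 0" if "w \<in> strip" for w
  proof (rule analytic_continuation[OF complex_mellin_holomorphic[OF \<Theta>], where U = "of_real ` {a<..<b}" and \<xi> = "of_real ((a + b) / 2)"])
    have strip_Int: "strip = {w. 0 < Re w} \<inter> {w. Re w < 1}" by (auto simp: strip_def)
    show "open strip"
      unfolding strip_Int by (intro open_Int open_halfspace_Re_gt open_halfspace_Re_lt)
    show "connected strip"
      unfolding strip_Int
      by (intro convex_connected convex_Int convex_halfspace_Re_gt convex_halfspace_Re_lt)
    show "(of_real ` {a<..<b} :: complex set) \<subseteq> strip" "complex_of_real ((a + b) / 2) \<in> strip"
      using ab by (auto simp: strip_def)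
    show "complex_of_real ((a + b) / 2) islimpt (of_real ` {a<..<b})"
      unfolding islimpt_approachable
    proof (intro allI impI)
      fix e :: real assume "0 < e"
      define d where "d = min (e / 2) ((b - a) / 4)"
      have "0 < d" "d < e" "d < (b - a) / 2" using \<open>0 < e\<close> ab by (auto simp: d_def min_def)
      then have "(a + b) / 2 + d \<in> {a<..<b}" by (auto simp: field_simps)
      moreover have "dist (complex_of_real ((a + b) / 2 + d)) (of_real ((a + b) / 2)) < e"
        using \<open>0 < d\<close> \<open>d < e\<close> unfolding dist_of_real by (simp add: dist_real_def)
      moreover have "complex_of_real ((a + b) / 2 + d) \<noteq> of_real ((a + b) / 2)"
        using \<open>0 < d\<close> by (simp only: of_real_eq_iff)
      ultimately show "\<exists>x'\<in>of_real ` {a<..<b}. x' \<noteq> complex_of_real ((a + b) / 2) \<and> dist x' (of_real ((a + b) / 2)) < e"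
        by blast
    qed
    show "complex_mellin \<Theta> z = 0" if "z \<in> complex_of_real ` {a<..<b}" for z
      using that zero complex_mellin_of_real[OF \<Theta>] by auto
  qed (rule that)
  define p where "p = (\<lambda>y. y powr (1/2) * max 0 (\<Theta> y))"
  define q where "q = (\<lambda>y. y powr (1/2) * max 0 (- \<Theta> y))"
  have half: "integrable lborel (\<lambda>y. y powr (1/2) * \<Theta> y)"
    by (rule profile_powr_integrable[OF \<Theta>]) auto
  have int: "integrable lborel p" "integrable lborel q"
    unfolding p_def q_def
    by (rule Bochner_Integration.integrable_bound[OF half]; auto simp: abs_mult intro!: AE_I2 mult_left_mono)+
  have "AE y in lborel. p y = q y"
  proof (rule density_eq_from_fourier[OF int])
    fix t :: real
    have osc: "integrable lborel (\<lambda>x. exp (\<i> * of_real (t * ln x)) * of_real (h x))"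
      if "integrable lborel h" for h :: "real \<Rightarrow> real"
    proof -
      have [measurable]: "h \<in> borel_measurable borel" using that by (auto dest: borel_measurable_integrable)
      show ?thesis
        by (rule Bochner_Integration.integrable_bound[OF that]) (auto simp: norm_mult norm_exp_eq_Re)
    qed
    have "(LINT x|lborel. exp (\<i> * of_real (t * ln x)) * of_real (p x)) - (LINT x|lborel. exp (\<i> * of_real (t * ln x)) * of_real (q x))
       = (LINT x|lborel. exp (\<i> * of_real (t * ln x)) * of_real (p x) - exp (\<i> * of_real (t * ln x)) * of_real (q x))"
      by (rule Bochner_Integration.integral_diff[symmetric]; rule osc; rule int)
    also have "\<dots> = complex_mellin \<Theta> (Complex (1/2) t)"
      unfolding complex_mellin_def
    proof (rule Bochner_Integration.integral_cong)
      fix x :: real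
      show "exp (\<i> * of_real (t * ln x)) * of_real (p x) - exp (\<i> * of_real (t * ln x)) * of_real (q x)
         = exp (Complex (1/2) t * of_real (ln x)) * of_real (\<Theta> x)"
      proof (cases "0 < x")
        case True
        have "Complex (1/2) t * of_real (ln x) = of_real (1/2 * ln x) + \<i> * of_real (t * ln x)"
          by (simp add: complex_eq_iff)
        then have "exp (Complex (1/2) t * of_real (ln x)) = of_real (x powr (1/2)) * exp (\<i> * of_real (t * ln x))"
          using True by (simp only: exp_add exp_of_real powr_def) simp
        moreover have "p x - q x = x powr (1/2) * \<Theta> x"
          by (auto simp: p_def q_def max_def)
        moreover have "exp (\<i> * of_real (t * ln x)) * complex_of_real (p x) - exp (\<i> * of_real (t * ln x)) * of_real (q x)
            = exp (\<i> * of_real (t * ln x)) * of_real (p x - q x)"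
          by (simp only: right_diff_distrib of_real_diff)
        ultimately show ?thesis
          by (simp only: of_real_mult mult_ac)
      qed (auto simp: p_def q_def profile_nonpos[OF \<Theta>])
    qed simp
    also have "\<dots> = 0" by (rule strip_zero) (simp add: strip_def)
    finally show "(LINT x|lborel. exp (\<i> * of_real (t * ln x)) * of_real (p x)) = (LINT x|lborel. exp (\<i> * of_real (t * ln x)) * of_real (q x))"
      by simp
  qed (auto simp: p_def q_def profile_nonpos[OF \<Theta>])
  then show ?thesis
  proof eventually_elim
    case (elim y)
    then show ?case
      using profile_nonpos[OF \<Theta>, of y] by (cases "0 < y") (auto simp: p_def q_def max_def split: if_splits)
  qed
qed

section \<open>Strict convexity of the kernel moments\<close>

definition kernel_moment :: "real measure \<Rightarrow> real \<Rightarrow> real" where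
  "kernel_moment k0 s = (LINT z:{0<..1}|k0. z powr s)"

lemma kernel_bounded_integrable:
  fixes h :: "real \<Rightarrow> real"
  assumes "fragmentation_kernel k0" "h \<in> borel_measurable borel"
    and "\<And>z. 0 < z \<Longrightarrow> z \<le> 1 \<Longrightarrow> \<bar>h z\<bar> \<le> C"
  shows "integrable k0 (\<lambda>z. indicator {0<..1} z * h z)"
proof -
  have fin: "finite_measure k0" and [measurable_cong]: "sets k0 = sets borel"
    using assms(1) by (auto simp: fragmentation_kernel_def)
  have [measurable]: "h \<in> borel_measurable k0"
    using assms(2) by measurable
  show ?thesis
  proof (rule finite_measure.integrable_const_bound[OF fin, where B = "max 0 C"])
    show "AE z in k0. norm (indicator {0<..1} z * h z) \<le> max 0 C"
      using assms(3) by (intro AE_I2) (auto simp: indicator_def max.coboundedI2)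
  qed measurable
qed

text \<open>
  Strict convexity of \<open>s \<mapsto> z\<^sup>s\<close>: after division by \<open>z powr s2\<close> it is the tangent inequality
  \<open>1 + u \<le> exp u\<close> at \<open>u = (s1 - s2) ln z\<close> and \<open>u = (s3 - s2) ln z\<close>, whose weighted mean is zero.
  Equality in the tangent inequality forces \<open>u = 0\<close>.
\<close>

lemma weighted_powr_ge:
  fixes z :: real
  assumes z: "0 < z" and l: "0 < l" "0 < m" "l + m = 1" and s: "l * s1 + m * s3 = s2"
  shows "z powr s2 \<le> l * z powr s1 + m * z powr s3"
    and "z powr s2 = l * z powr s1 + m * z powr s3 \<Longrightarrow> s1 \<noteq> s2 \<Longrightarrow> z = 1"
proof -
  define L where "L = ln z"
  have factor: "z powr r = z powr s2 * exp ((r - s2) * L)" for r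
    using z by (simp add: powr_def L_def algebra_simps flip: exp_add)
  have mean: "l * ((s1 - s2) * L) + m * ((s3 - s2) * L) = 0"
  proof -
    have "l * ((s1 - s2) * L) + m * ((s3 - s2) * L) = (l * s1 + m * s3 - (l + m) * s2) * L"
      by algebra
    then show ?thesis using l s by simp
  qed
  have tangent: "1 + u \<le> exp u" for u :: real by (rule exp_ge_add_one_self)
  have 1: "l * (1 + (s1 - s2) * L) \<le> l * exp ((s1 - s2) * L)"
    and 3: "m * (1 + (s3 - s2) * L) \<le> m * exp ((s3 - s2) * L)"
    using l tangent by (simp_all add: mult_left_mono)
  have split: "l * (1 + (s1 - s2) * L) + m * (1 + (s3 - s2) * L) = 1"
    using mean l by (simp add: distrib_left)
  have eq: "l * z powr s1 + m * z powr s3 = z powr s2 * (l * exp ((s1 - s2) * L) + m * exp ((s3 - s2) * L))"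
    by (subst factor[of s1], subst factor[of s3]) (simp add: algebra_simps)
  have "1 \<le> l * exp ((s1 - s2) * L) + m * exp ((s3 - s2) * L)"
    using 1 3 split by linarith
  then show "z powr s2 \<le> l * z powr s1 + m * z powr s3"
    unfolding eq using mult_left_mono[of 1 _ "z powr s2"] by simp
  assume "z powr s2 = l * z powr s1 + m * z powr s3" and ne: "s1 \<noteq> s2"
  then have "l * exp ((s1 - s2) * L) + m * exp ((s3 - s2) * L) = 1"
    unfolding eq using z by simp
  then have "l * exp ((s1 - s2) * L) = l * (1 + (s1 - s2) * L)"
    using 1 3 split by linarith
  then have "exp ((s1 - s2) * L) = 1 + (s1 - s2) * L" using l by simp
  then have "ln (exp ((s1 - s2) * L)) = exp ((s1 - s2) * L) - 1"
    unfolding ln_exp by linarith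
  then have "exp ((s1 - s2) * L) = 1"
    by (rule ln_eq_minus_one[OF exp_gt_zero])
  then have "L = 0" using ne by simp
  then show "z = 1" using z by (simp add: L_def)
qed

text \<open>
  If the moments at three points lie on a line, the nonnegative convexity gap has integral zero, so
  \<open>k0\<close> restricted to \<open>(0,1]\<close> is concentrated at \<open>z = 1\<close>.  Then its mass \<open>\<integral> z dk0\<close> and its number of
  fragments \<open>k0 (0,1]\<close> coincide, whereas the first is \<open>1\<close> and the second exceeds \<open>1\<close>.
\<close>

lemma kernel_moment_not_affine:
  assumes k0: "fragmentation_kernel k0" and s: "0 \<le> s1" "s1 < s2" "s2 < s3"
    and affine: "\<And>s. s \<in> {s1, s2, s3} \<Longrightarrow> kernel_moment k0 s = A + B * s"
  shows False
proof -
  have fin: "finite_measure k0" and sets[measurable_cong]: "sets k0 = sets borel"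
    and mass: "(LINT z:{0<..1}|k0. z) = 1" and number: "measure k0 {0<..1} > 1"
    using k0 by (auto simp: fragmentation_kernel_def)
  define l where "l = (s3 - s2) / (s3 - s1)"
  define m where "m = (s2 - s1) / (s3 - s1)"
  have lm: "0 < l" "0 < m" "l + m = 1" "l * s1 + m * s3 = s2"
    using s by (auto simp: l_def m_def divide_simps) (auto simp: algebra_simps)
  have powr_int: "integrable k0 (\<lambda>z. indicator {0<..1} z * z powr s)" if "0 \<le> s" for s
    using that by (intro kernel_bounded_integrable[OF k0, where C = 1]) (auto simp: powr_le1)
  define gap where "gap = (\<lambda>z. indicator {0<..1} z * (l * z powr s1 + m * z powr s3 - z powr s2))"
  have gap_eq: "gap z = l * (indicator {0<..1} z * z powr s1) + m * (indicator {0<..1} z * z powr s3)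
      - indicator {0<..1} z * z powr s2" for z
    by (simp add: gap_def algebra_simps)
  have gap_int: "integrable k0 gap"
    unfolding gap_eq using s powr_int by (intro Bochner_Integration.integrable_diff Bochner_Integration.integrable_add integrable_mult_right) auto
  have "(LINT z|k0. gap z) = l * kernel_moment k0 s1 + m * kernel_moment k0 s3 - kernel_moment k0 s2"
    unfolding gap_eq kernel_moment_def set_lebesgue_integral_def using s powr_int by simp
  also have "\<dots> = (l + m - 1) * A + B * (l * s1 + m * s3 - s2)"
    using affine by (simp add: algebra_simps)
  also have "\<dots> = 0" using lm by simp
  finally have "(LINT z|k0. gap z) = 0" .
  moreover have "0 \<le> gap z" for z
    using weighted_powr_ge(1)[OF _ lm, of z] by (auto simp: gap_def indicator_def)
  ultimately have "AE z in k0. gap z = 0"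
    using integral_nonneg_eq_0_iff_AE[OF gap_int] by simp
  then have "AE z in k0. indicator {0<..1} z * z = (indicator {0<..1} z :: real)"
  proof eventually_elim
    case (elim z)
    then show ?case
      using weighted_powr_ge(2)[OF _ lm, of z] s by (auto simp: gap_def indicator_def split: if_splits)
  qed
  then have "(LINT z|k0. indicator {0<..1} z * z) = (LINT z|k0. indicator {0<..1} z)"
    by (intro integral_cong_AE) auto
  also have "\<dots> = measure k0 {0<..1}"
    using sets by (simp add: sets_eq_imp_space_eq[OF sets])
  finally show False
    using mass number by (simp add: set_lebesgue_integral_def)
qed

section \<open>Dilations and the fragmentation operator\<close>

definition fragment :: "real measure \<Rightarrow> (real \<Rightarrow> real) \<Rightarrow> real \<Rightarrow> real" where
  "fragment k0 \<Theta> y = (LINT z:{0<..1}|k0. \<Theta> (y / z) / z)"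

lemma lborel_integral_dilation:
  fixes h :: "real \<Rightarrow> real"
  assumes "0 < c"
  shows "(LINT x|lborel. h (x * c)) = (LINT y|lborel. h y) / c"
  using lborel_integral_real_affine[of c h 0] assms by (simp add: mult.commute)

lemma lborel_integrable_dilation:
  fixes h :: "real \<Rightarrow> real"
  assumes "0 < c" "integrable lborel h"
  shows "integrable lborel (\<lambda>x. h (x * c))"
  using lborel_integrable_real_affine[OF assms(2), of c 0] assms by (simp add: mult.commute)

lemma profile_integrable_abs:
  assumes "profile \<Theta>"
  shows "integrable lborel (\<lambda>y. \<bar>\<Theta> y\<bar>)" "integrable lborel (\<lambda>y. y * \<bar>\<Theta> y\<bar>)"
proof -
  show "integrable lborel (\<lambda>y. \<bar>\<Theta> y\<bar>)"
    using integrable_abs[OF profile_powr_integrable[OF assms, of 0]] 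
    by (rule Bochner_Integration.integrable_cong[THEN iffD1, rotated -1]) (auto simp: profile_nonpos[OF assms])
  show "integrable lborel (\<lambda>y. y * \<bar>\<Theta> y\<bar>)"
    using integrable_abs[OF profile_powr_integrable[OF assms, of 1]]
    by (rule Bochner_Integration.integrable_cong[THEN iffD1, rotated -1]) (auto simp: abs_mult profile_nonpos[OF assms] not_less)
qed

text \<open>
  The explicit value makes these weighted norms integrable over the dilation factor: over \<open>c = 1/z\<close>
  against \<open>k0\<close>, and over \<open>c = g t\<close> for \<open>t\<close> in a compact interval.
\<close>

lemma profile_dilation:
  assumes "profile \<Theta>" "0 < c"
  shows "integrable lborel (\<lambda>x. (1 + x) * \<bar>\<Theta> (x * c)\<bar>)"
    and "(LINT x|lborel. (1 + x) * \<bar>\<Theta> (x * c)\<bar>)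
      = (LINT y|lborel. \<bar>\<Theta> y\<bar>) / c + (LINT y|lborel. y * \<bar>\<Theta> y\<bar>) / c\<^sup>2"
proof -
  let ?h = "\<lambda>y. \<bar>\<Theta> y\<bar> + (y * \<bar>\<Theta> y\<bar>) / c"
  have eq: "(1 + x) * \<bar>\<Theta> (x * c)\<bar> = ?h (x * c)" for x
    using assms(2) by (simp add: algebra_simps)
  have int: "integrable lborel ?h" using profile_integrable_abs[OF assms(1)] by simp
  show "integrable lborel (\<lambda>x. (1 + x) * \<bar>\<Theta> (x * c)\<bar>)"
    unfolding eq by (rule lborel_integrable_dilation[OF assms(2) int])
  show "(LINT x|lborel. (1 + x) * \<bar>\<Theta> (x * c)\<bar>)
      = (LINT y|lborel. \<bar>\<Theta> y\<bar>) / c + (LINT y|lborel. y * \<bar>\<Theta> y\<bar>) / c\<^sup>2"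
  proof -
    have "(LINT x|lborel. ?h (x * c)) = (LINT y|lborel. ?h y) / c"
      by (rule lborel_integral_dilation[OF assms(2)])
    then show ?thesis
      unfolding eq using profile_integrable_abs[OF assms(1)]
      by (simp add: add_divide_distrib power2_eq_square)
  qed
qed

lemma mellin_dilation:
  assumes "profile \<Theta>" "0 < c"
  shows "(LINT x|lborel. x powr s * \<Theta> (x * c)) = c powr (- s - 1) * mellin \<Theta> s"
proof -
  have "x powr s * \<Theta> (x * c) = c powr (- s) * ((x * c) powr s * \<Theta> (x * c))" for x
  proof (cases "0 < x")
    case True
    then show ?thesis using assms(2) by (simp add: powr_mult powr_minus)
  next
    case False
    then have "\<Theta> (x * c) = 0" using assms by (intro profile_nonpos) (auto simp: mult_le_0_iff)
    then show ?thesis by simp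
  qed
  then have "(LINT x|lborel. x powr s * \<Theta> (x * c)) = (LINT x|lborel. c powr (- s) * ((x * c) powr s * \<Theta> (x * c)))"
    by (simp only:)
  also have "\<dots> = c powr (- s) * (LINT x|lborel. (x * c) powr s * \<Theta> (x * c))"
    by simp
  also have "\<dots> = c powr (- s) * (mellin \<Theta> s / c)"
    unfolding mellin_def by (subst lborel_integral_dilation[OF assms(2), symmetric]) simp
  also have "\<dots> = c powr (- s - 1) * mellin \<Theta> s"
    using assms(2) by (simp add: powr_diff)
  finally show ?thesis .
qed

text \<open>
  The fragmentation operator is an average of dilations, so the Mellin transform diagonalises it, with
  the kernel moments as eigenvalues.  The Fubini argument rests on the weight \<open>1 + y\<close>, which
  dominates every \<open>y powr s\<close> with \<open>0 \<le> s \<le> 1\<close>.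
\<close>

lemma fragment_profile:
  assumes k0: "fragmentation_kernel k0" and \<Theta>: "profile \<Theta>"
  shows "profile (fragment k0 \<Theta>)"
    and "0 \<le> s \<Longrightarrow> s \<le> 1 \<Longrightarrow> mellin (fragment k0 \<Theta>) s = kernel_moment k0 s * mellin \<Theta> s"
proof -
  have fin: "finite_measure k0" and [measurable_cong]: "sets k0 = sets borel"
    using k0 by (auto simp: fragmentation_kernel_def)
  interpret K: finite_measure k0 by (rule fin)
  interpret P: pair_sigma_finite k0 lborel ..
  have [measurable]: "\<Theta> \<in> borel_measurable borel" by (rule profile_borel[OF \<Theta>])
  define a where "a = (LINT y|lborel. \<bar>\<Theta> y\<bar>)"
  define b where "b = (LINT y|lborel. y * \<bar>\<Theta> y\<bar>)"
  define D where "D = (\<lambda>(z, y). indicator {0<..1} z * ((1 + y) * (\<Theta> (y / z) / z)))"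
  have [measurable]: "D \<in> borel_measurable (k0 \<Otimes>\<^sub>M lborel)"
    unfolding D_def by measurable
  have D_norm: "norm (D (z, y)) = indicator {0<..1} z / z * ((1 + y) * \<bar>\<Theta> (y * (1 / z))\<bar>)" for z y
    using profile_nonpos[OF \<Theta>, of "y / z"]
    by (cases "0 < y") (auto simp: D_def indicator_def abs_mult divide_nonpos_pos)
  have D_int: "integrable (k0 \<Otimes>\<^sub>M lborel) D"
  proof (rule P.Fubini_integrable)
    have "(LINT y|lborel. norm (D (z, y))) = indicator {0<..1} z * (a + b * z)" for z
    proof (cases "z \<in> {0<..1}")
      case True
      then show ?thesis
        unfolding D_norm using profile_dilation(2)[OF \<Theta>, of "1 / z"]
        by (simp add: a_def b_def field_simps power2_eq_square)
    qed (simp add: D_norm del: real_norm_def)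
    moreover have "\<bar>a + b * z\<bar> \<le> \<bar>a\<bar> + \<bar>b\<bar>" if "0 < z" "z \<le> 1" for z
    proof -
      have "\<bar>b * z\<bar> \<le> \<bar>b\<bar>" using that by (simp add: abs_mult mult_left_le)
      then show ?thesis by linarith
    qed
    ultimately show "integrable k0 (\<lambda>z. LINT y|lborel. norm (D (z, y)))"
      using kernel_bounded_integrable[OF k0, of "\<lambda>z. a + b * z" "\<bar>a\<bar> + \<bar>b\<bar>"] by simp
    show "AE z in k0. integrable lborel (\<lambda>y. D (z, y))"
    proof (rule AE_I2)
      fix z
      have "integrable lborel (\<lambda>y. norm (D (z, y)))"
        unfolding D_norm using profile_dilation(1)[OF \<Theta>, of "1 / z"]
        by (cases "z \<in> {0<..1}") (simp_all add: indicator_def)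
      then show "integrable lborel (\<lambda>y. D (z, y))"
        by (rule integrable_norm_cancel) (simp add: D_def)
    qed
  qed measurable
  have "integrable lborel (\<lambda>y. LINT z|k0. D (z, y))"
    using P.integrable_snd[of "\<lambda>z y. D (z, y)"] D_int by simp
  moreover have "(LINT z|k0. D (z, y)) = (1 + y) * fragment k0 \<Theta> y" for y
  proof -
    have "D (z, y) = (1 + y) * (indicator {0<..1} z * (\<Theta> (y / z) / z))" for z
      by (simp add: D_def)
    then show ?thesis
      unfolding fragment_def set_lebesgue_integral_def
      by (simp only: integral_mult_right_zero real_scaleR_def)
  qed
  ultimately show "profile (fragment k0 \<Theta>)"
    using \<Theta> unfolding profile_def fragment_def set_lebesgue_integral_def
    by (auto intro!: integral_eq_zero_AE AE_I2 simp: indicator_def divide_nonpos_pos)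
  assume s: "0 \<le> s" "s \<le> 1"
  define W where "W = (\<lambda>z y. indicator {0<..1} z * (y powr s * (\<Theta> (y / z) / z)))"
  have W_int: "integrable (k0 \<Otimes>\<^sub>M lborel) (case_prod W)"
  proof (rule Bochner_Integration.integrable_bound[OF D_int])
    show "case_prod W \<in> borel_measurable (k0 \<Otimes>\<^sub>M lborel)"
      unfolding W_def by measurable
    have "norm (W z y) \<le> norm (D (z, y))" for z y
    proof (cases "z \<in> {0<..1} \<and> 0 < y")
      case True
      then show ?thesis
        using powr_le_one_plus[of y s] s
        by (auto simp: W_def D_def abs_mult intro!: mult_right_mono divide_right_mono)
    next
      case False
      then show ?thesis
        using profile_nonpos[OF \<Theta>, of "y / z"] by (auto simp: W_def D_def indicator_def divide_nonpos_pos)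
    qed
    then show "AE p in k0 \<Otimes>\<^sub>M lborel. norm (case_prod W p) \<le> norm (D p)"
      by (intro AE_I2) (auto split: prod.split)
  qed
  have W_eq: "W z y = y powr s * (indicator {0<..1} z * (\<Theta> (y / z) / z))" for z y
    by (simp add: W_def)
  have "mellin (fragment k0 \<Theta>) s = (LINT y|lborel. LINT z|k0. W z y)"
    unfolding mellin_def W_eq fragment_def set_lebesgue_integral_def
    by (simp only: integral_mult_right_zero real_scaleR_def)
  also have "\<dots> = (LINT z|k0. LINT y|lborel. W z y)"
    by (rule P.Fubini_integral[OF W_int])
  also have "\<dots> = (LINT z|k0. (indicator {0<..1} z * z powr s) * mellin \<Theta> s)"
  proof (rule Bochner_Integration.integral_cong)
    fix z
    show "(LINT y|lborel. W z y) = (indicator {0<..1} z * z powr s) * mellin \<Theta> s"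
    proof (cases "z \<in> {0<..1}")
      case True
      have "(LINT y|lborel. W z y) = (LINT y|lborel. y powr s * \<Theta> (y * (1 / z))) / z"
        using True by (simp add: W_def)
      also have "\<dots> = (1 / z) powr (- s - 1) / z * mellin \<Theta> s"
        using True by (subst mellin_dilation[OF \<Theta>]) auto
      also have "(1 / z) powr (- s - 1) / z = z powr s"
        using True by (simp add: powr_divide powr_diff powr_minus)
      finally show ?thesis using True by simp
    qed (simp add: W_def)
  qed simp
  also have "\<dots> = kernel_moment k0 s * mellin \<Theta> s"
    by (simp add: kernel_moment_def set_lebesgue_integral_def)
  finally show "mellin (fragment k0 \<Theta>) s = kernel_moment k0 s * mellin \<Theta> s" .
qed

section \<open>Test functions\<close>

lemma zero_extension_C1:
  fixes h h' :: "real \<Rightarrow> real"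
  assumes a: "0 < a"
    and deriv: "\<And>x. 0 < x \<Longrightarrow> (h has_real_derivative h' x) (at x)"
    and cont: "continuous_on {0<..} h'"
    and zero: "\<And>x. 0 < x \<Longrightarrow> x < a \<Longrightarrow> h x = 0"
  shows "((\<lambda>x. if 0 < x then h x else 0) has_real_derivative (if 0 < x then h' x else 0)) (at x)"
    and "continuous_on UNIV (\<lambda>x. if 0 < x then h' x else 0)"
proof -
  have deriv0: "h' x = 0" if "0 < x" "x < a" for x
  proof (rule DERIV_unique[OF deriv[OF that(1)]])
    show "(h has_real_derivative 0) (at x)"
      by (rule has_field_derivative_transform_within_open[OF DERIV_const[of 0], where S = "{0<..<a}"])
        (use that zero in auto)
  qed
  show "((\<lambda>x. if 0 < x then h x else 0) has_real_derivative (if 0 < x then h' x else 0)) (at x)"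
  proof (cases "0 < x")
    case True
    then have "((\<lambda>x. if 0 < x then h x else 0) has_real_derivative h' x) (at x)"
      by (intro has_field_derivative_transform_within_open[OF deriv[OF True], where S = "{0<..}"]) auto
    then show ?thesis using True by simp
  next
    case False
    then have "((\<lambda>x. if 0 < x then h x else 0) has_real_derivative 0) (at x)"
      by (intro has_field_derivative_transform_within_open[OF DERIV_const[of 0], where S = "{..<a}"])
        (use a zero in auto)
    then show ?thesis using False by simp
  qed
  have "continuous_on ({0<..} \<union> {..<a}) (\<lambda>x. if 0 < x then h' x else 0)"
  proof (rule continuous_on_open_Un)
    show "continuous_on {0<..} (\<lambda>x. if 0 < x then h' x else 0)"
      using cont by (rule continuous_on_eq) auto
    show "continuous_on {..<a} (\<lambda>x. if 0 < x then h' x else 0)"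
      by (rule continuous_on_eq[OF continuous_on_const[of _ 0]]) (use deriv0 in auto)
  qed auto
  moreover have "{0<..} \<union> {..<a} = UNIV" using a by auto
  ultimately show "continuous_on UNIV (\<lambda>x. if 0 < x then h' x else 0)" by simp
qed

text \<open>
  The square of the positive part is continuously differentiable and vanishes on a half-line: enough
  regularity to build compactly supported \<open>C\<^sup>1\<close> functions without smooth bumps.
\<close>

definition pos_square :: "real \<Rightarrow> real" where "pos_square u = (max 0 u)\<^sup>2"

lemma pos_square_has_derivative:
  "(pos_square has_real_derivative 2 * max 0 u) (at u)"
proof -
  have bound: "\<bar>pos_square v - pos_square u - 2 * max 0 u * (v - u)\<bar> \<le> (v - u)\<^sup>2" for v
  proof (cases "0 \<le> u"; cases "0 \<le> v")
    assume "0 \<le> u" "\<not> 0 \<le> v"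
    then have "\<bar>pos_square v - pos_square u - 2 * max 0 u * (v - u)\<bar> = \<bar>(v - u)\<^sup>2 - v\<^sup>2\<bar>"
      by (simp add: pos_square_def power2_eq_square algebra_simps)
    moreover have "(- v)\<^sup>2 \<le> (u - v)\<^sup>2"
      using \<open>0 \<le> u\<close> \<open>\<not> 0 \<le> v\<close> by (intro power_mono) auto
    then have "v\<^sup>2 \<le> (v - u)\<^sup>2" by (simp add: power2_commute)
    ultimately show ?thesis by simp
  next
    assume "\<not> 0 \<le> u" "0 \<le> v"
    then have "v\<^sup>2 \<le> (v - u)\<^sup>2" by (intro power_mono) auto
    then show ?thesis using \<open>\<not> 0 \<le> u\<close> \<open>0 \<le> v\<close> by (simp add: pos_square_def max_def)
  next
    assume "0 \<le> u" "0 \<le> v"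
    then have "pos_square v - pos_square u - 2 * max 0 u * (v - u) = (v - u)\<^sup>2"
      by (simp add: pos_square_def power2_eq_square algebra_simps)
    then show ?thesis by simp
  qed (simp add: pos_square_def)
  show ?thesis
    unfolding has_field_derivative_def
  proof (rule has_derivativeI_sandwich[where e = 1 and H = "\<lambda>v. \<bar>v - u\<bar>"])
    show "norm (pos_square v - pos_square u - 2 * max 0 u * (v - u)) / norm (v - u) \<le> \<bar>v - u\<bar>"
      if "v \<noteq> u" for v
      using bound[of v] that by (simp add: divide_le_eq power2_eq_square abs_mult_self_eq)
    have "((\<lambda>v. \<bar>v - u\<bar>) \<longlongrightarrow> \<bar>u - u\<bar>) (at u)" by (intro tendsto_intros)
    then show "((\<lambda>v. \<bar>v - u\<bar>) \<longlongrightarrow> 0) (at u)" by simp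
  qed (simp_all add: bounded_linear_mult_right)
qed

lemma pos_square_derivative [derivative_intros]:
  assumes "(k has_real_derivative d) (at x within S)"
  shows "((\<lambda>x. pos_square (k x)) has_real_derivative 2 * max 0 (k x) * d) (at x within S)"
  using DERIV_chain2[OF pos_square_has_derivative assms] .

text \<open>
  The expression \<open>x + 1/x\<close> tends to infinity at both ends of the half-line, so a single condition
  \<open>x + 1/x < n\<close> keeps \<open>x\<close> away from \<open>0\<close> and from infinity.
\<close>

definition cutoff :: "nat \<Rightarrow> real \<Rightarrow> real" where
  "cutoff n x = pos_square (1 - (x + 1 / x) / real n)"

lemma cutoff_bounds: "0 < x \<Longrightarrow> 0 \<le> cutoff n x \<and> cutoff n x \<le> 1"
proof -
  assume x: "0 < x"
  have "max 0 (1 - (x + 1 / x) / real n) \<le> 1" using x by simp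
  then show ?thesis
    by (auto simp: cutoff_def pos_square_def intro!: power_le_one)
qed

lemma cutoff_support:
  assumes "0 < x" "0 < n" "cutoff n x \<noteq> 0"
  shows "1 / real n \<le> x" "x \<le> real n"
proof -
  have "0 < 1 - (x + 1 / x) / real n"
  proof (rule ccontr)
    assume "\<not> 0 < 1 - (x + 1 / x) / real n"
    then have "max 0 (1 - (x + 1 / x) / real n) = 0" by (intro max_absorb1) linarith
    then show False using assms(3) by (simp add: cutoff_def pos_square_def)
  qed
  then have "x + 1 / x < real n" using assms(2) by (simp add: field_simps)
  moreover have "0 < 1 / x" using assms(1) by simp
  ultimately have "1 / x < real n" "x < real n" using assms(1) by linarith+
  then show "1 / real n \<le> x" "x \<le> real n" using assms by (auto simp: field_simps)
qed

lemma cutoff_tendsto: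
  "(\<lambda>n. cutoff n x) \<longlonglongrightarrow> 1"
proof -
  have "(\<lambda>n. (max 0 (1 - (x + 1 / x) * inverse (real n)))\<^sup>2) \<longlonglongrightarrow> (max 0 (1 - (x + 1 / x) * 0))\<^sup>2"
    by (intro tendsto_intros lim_inverse_n)
  then show ?thesis by (simp add: cutoff_def[abs_def] pos_square_def divide_inverse)
qed

definition truncated_power :: "real \<Rightarrow> nat \<Rightarrow> real \<Rightarrow> real" where
  "truncated_power s n x = (if 0 < x then x powr s * cutoff n x else 0)"

lemma truncated_power_C1:
  assumes "0 < n"
  shows "\<exists>D. (\<forall>x. (truncated_power s n has_real_derivative D x) (at x)) \<and> continuous_on UNIV D"
proof -
  let ?D = "\<lambda>x. x powr s * (2 * max 0 (1 - (x + 1 / x) / real n) * ((1 / x\<^sup>2 - 1) / real n))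
     + s * x powr (s - 1) * cutoff n x"
  have D: "((\<lambda>x. x powr s * cutoff n x) has_real_derivative ?D x) (at x)" if "0 < x" for x
  proof -
    have inner: "((\<lambda>x. 1 - (x + 1 / x) / real n) has_real_derivative (1 / x\<^sup>2 - 1) / real n) (at x)"
      using that assms by (auto intro!: derivative_eq_intros simp: power2_eq_square diff_divide_distrib)
    show ?thesis
      using DERIV_mult[OF has_real_derivative_powr[OF that] pos_square_derivative[OF inner]]
      unfolding cutoff_def by (simp add: add.commute mult_ac)
  qed
  have C: "continuous_on {0<..} ?D"
    unfolding cutoff_def pos_square_def using assms by (intro continuous_intros) auto
  have zero: "x powr s * cutoff n x = 0" if "0 < x" "x < 1 / real n" for x
    using cutoff_support(1)[of x n] that assms by force
  have pos: "0 < 1 / real n" using assms by simp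
  show ?thesis
    unfolding truncated_power_def[abs_def]
    by (intro exI conjI allI; rule zero_extension_C1[OF pos D C zero])
qed

lemma product_test_function:
  fixes \<alpha> \<eta> \<alpha>' \<eta>' :: "real \<Rightarrow> real"
  assumes \<alpha>: "\<And>t. (\<alpha> has_real_derivative \<alpha>' t) (at t)" "continuous_on UNIV \<alpha>'"
    and \<eta>: "\<And>x. (\<eta> has_real_derivative \<eta>' x) (at x)" "continuous_on UNIV \<eta>'"
    and supp: "0 < a" "\<And>t. t \<notin> {a..b} \<Longrightarrow> \<alpha> t = 0" "0 < c" "\<And>x. x \<notin> {c..d} \<Longrightarrow> \<eta> x = 0"
  shows "C1_test_function_on (\<lambda>(t, x). \<alpha> t * \<eta> x) quadrant"
  unfolding C1_test_function_on_def
proof (intro conjI exI allI impI)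
  show "compact ({a..b} \<times> {c..d})" "{a..b} \<times> {c..d} \<subseteq> quadrant"
    using supp by (auto simp: quadrant_def intro!: compact_Times)
  fix p assume "p \<notin> {a..b} \<times> {c..d}"
  then show "(case p of (t, x) \<Rightarrow> \<alpha> t * \<eta> x) = 0"
    using supp by (cases p) auto
next
  let ?D = "\<lambda>p. (\<alpha>' (fst p) * \<eta> (snd p)) *\<^sub>R fst_blinfun + (\<alpha> (fst p) * \<eta>' (snd p)) *\<^sub>R snd_blinfun"
  fix p :: "real \<times> real"
  have "((\<lambda>p. \<alpha> (fst p) * \<eta> (snd p)) has_derivative
      (\<lambda>v. \<alpha> (fst p) * (snd v * \<eta>' (snd p)) + fst v * \<alpha>' (fst p) * \<eta> (snd p))) (at p)"
    by (intro has_derivative_mult DERIV_compose_FDERIV \<alpha>(1) \<eta>(1) has_derivative_fst has_derivative_snd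
        has_derivative_ident)
  moreover have "blinfun_apply (?D p) = (\<lambda>v. \<alpha> (fst p) * (snd v * \<eta>' (snd p)) + fst v * \<alpha>' (fst p) * \<eta> (snd p))"
    by (auto simp: fun_eq_iff blinfun.bilinear_simps)
  ultimately show "((\<lambda>(t, x). \<alpha> t * \<eta> x) has_derivative blinfun_apply (?D p)) (at p)"
    by (simp add: case_prod_beta')
next
  let ?D = "\<lambda>p. (\<alpha>' (fst p) * \<eta> (snd p)) *\<^sub>R fst_blinfun + (\<alpha> (fst p) * \<eta>' (snd p)) *\<^sub>R snd_blinfun"
  have lift: "continuous_on UNIV (\<lambda>p :: real \<times> real. h (fst p))" "continuous_on UNIV (\<lambda>p :: real \<times> real. h (snd p))"
    if "continuous_on UNIV h" for h :: "real \<Rightarrow> real"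
    by (rule continuous_on_compose2[OF that], simp_all add: continuous_on_fst continuous_on_snd)+
  have "continuous_on UNIV \<alpha>" "continuous_on UNIV \<eta>"
    using DERIV_isCont[OF \<alpha>(1)] DERIV_isCont[OF \<eta>(1)] by (simp_all add: continuous_at_imp_continuous_on)
  from lift(1)[OF this(1)] lift(2)[OF this(2)] lift(1)[OF \<alpha>(2)] lift(2)[OF \<eta>(2)]
  show "continuous_on UNIV ?D"
    by (intro continuous_intros)
qed

section \<open>The Mellin transform of the weak equation\<close>

text \<open>
  The power \<open>x powr s\<close> is not an admissible test function, but its truncations are.  Since they are
  dominated by \<open>1 + x\<close>, the limit may be taken under the double integral.  The same statement serves
  both sides of the equation: for a self-similar \<open>u\<close> the gain term is self-similar too, with the
  profile \<open>\<Theta>\<close> replaced by its image under the fragmentation operator.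
\<close>

lemma scaled_profile_limit:
  fixes b G :: "real \<Rightarrow> real"
  assumes \<Theta>: "profile \<Theta>" and s: "0 \<le> s" "s \<le> 1"
    and [measurable]: "b \<in> borel_measurable borel" "G \<in> borel_measurable borel"
    and G: "\<And>t. 0 < G t"
    and int: "integrable lborel (\<lambda>t. b t / G t)" "integrable lborel (\<lambda>t. b t / (G t)\<^sup>2)"
  shows "(\<lambda>n. LINT p|lborel. b (fst p) * \<Theta> (snd p * G (fst p)) * truncated_power s n (snd p))
     \<longlonglongrightarrow> (LINT t|lborel. b t * G t powr (- s - 1)) * mellin \<Theta> s"
proof -
  have [measurable]: "\<Theta> \<in> borel_measurable borel" by (rule profile_borel[OF \<Theta>])
  define D where "D = (\<lambda>p. b (fst p) * ((1 + snd p) * \<Theta> (snd p * G (fst p))))"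
  define W where "W = (\<lambda>p. b (fst p) * \<Theta> (snd p * G (fst p)) * snd p powr s)"
  have [measurable]: "D \<in> borel_measurable (lborel \<Otimes>\<^sub>M lborel)" "W \<in> borel_measurable (lborel \<Otimes>\<^sub>M lborel)"
    unfolding D_def W_def by measurable
  have neg: "\<Theta> (x * G t) = 0" if "x \<le> 0" for x t
    using that G[of t] by (intro profile_nonpos[OF \<Theta>]) (simp add: mult_le_0_iff)
  have D_norm: "norm (D (t, x)) = \<bar>b t\<bar> * ((1 + x) * \<bar>\<Theta> (x * G t)\<bar>)" for t x
    using neg[of x t] by (cases "0 < x") (auto simp: D_def abs_mult)
  have D_int: "integrable (lborel \<Otimes>\<^sub>M lborel) D"
  proof (rule lborel_pair.Fubini_integrable)
    have "(LINT x|lborel. norm (D (t, x))) = (LINT y|lborel. \<bar>\<Theta> y\<bar>) * \<bar>b t / G t\<bar> + (LINT y|lborel. y * \<bar>\<Theta> y\<bar>) * \<bar>b t / (G t)\<^sup>2\<bar>" for t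
      unfolding D_norm using profile_dilation(2)[OF \<Theta> G, of t] G[of t]
      by (simp add: abs_mult distrib_left mult.commute)
    then show "integrable lborel (\<lambda>t. LINT x|lborel. norm (D (t, x)))"
      using integrable_abs[OF int(1)] integrable_abs[OF int(2)]
      by (simp only: Bochner_Integration.integrable_add integrable_mult_right)
    show "AE t in lborel. integrable lborel (\<lambda>x. D (t, x))"
    proof (rule AE_I2)
      fix t
      have "integrable lborel (\<lambda>x. norm (D (t, x)))"
        unfolding D_norm using profile_dilation(1)[OF \<Theta> G, of t] by simp
      then show "integrable lborel (\<lambda>x. D (t, x))"
        by (rule integrable_norm_cancel) (simp add: D_def)
    qed
  qed measurable
  have trunc: "\<bar>truncated_power s n x\<bar> \<le> 1 + x" if "0 < x" for n x
  proof -
    have "x powr s * cutoff n x \<le> (1 + x) * 1"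
      using that s cutoff_bounds[OF that, of n] by (intro mult_mono powr_le_one_plus) auto
    then show ?thesis
      using that cutoff_bounds[OF that, of n] by (simp add: truncated_power_def abs_mult)
  qed
  have dom: "norm (b t * \<Theta> (x * G t) * w) \<le> norm (D (t, x))" if "0 < x \<Longrightarrow> \<bar>w\<bar> \<le> 1 + x" for t x w
  proof (cases "0 < x")
    case True
    have "\<bar>b t * \<Theta> (x * G t)\<bar> * \<bar>w\<bar> \<le> \<bar>b t * \<Theta> (x * G t)\<bar> * (1 + x)"
      using that[OF True] by (intro mult_left_mono) auto
    then show ?thesis using True by (simp add: D_norm abs_mult mult_ac del: real_norm_def) (simp add: abs_mult mult_ac)
  qed (use neg[of x t] in auto)
  have trunc_meas [measurable]: "truncated_power s n \<in> borel_measurable borel" for n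
    unfolding truncated_power_def[abs_def] cutoff_def pos_square_def by measurable
  have "(\<lambda>n. LINT p|(lborel \<Otimes>\<^sub>M lborel). b (fst p) * \<Theta> (snd p * G (fst p)) * truncated_power s n (snd p))
     \<longlonglongrightarrow> (LINT p|(lborel \<Otimes>\<^sub>M lborel). W p)"
  proof (rule integral_dominated_convergence[where w = "\<lambda>p. norm (D p)"])
    show "integrable (lborel \<Otimes>\<^sub>M lborel) (\<lambda>p. norm (D p))" using D_int by (rule integrable_norm)
    show "AE p in (lborel \<Otimes>\<^sub>M lborel). norm (b (fst p) * \<Theta> (snd p * G (fst p)) * truncated_power s n (snd p)) \<le> norm (D p)" for n
      by (intro AE_I2) (metis dom trunc prod.collapse)
    show "AE p in (lborel \<Otimes>\<^sub>M lborel). (\<lambda>n. b (fst p) * \<Theta> (snd p * G (fst p)) * truncated_power s n (snd p)) \<longlonglongrightarrow> W p"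
    proof (rule AE_I2)
      fix p :: "real \<times> real"
      show "(\<lambda>n. b (fst p) * \<Theta> (snd p * G (fst p)) * truncated_power s n (snd p)) \<longlonglongrightarrow> W p"
      proof (cases "0 < snd p")
        case True
        have "(\<lambda>n. b (fst p) * \<Theta> (snd p * G (fst p)) * (snd p powr s * cutoff n (snd p)))
          \<longlonglongrightarrow> b (fst p) * \<Theta> (snd p * G (fst p)) * (snd p powr s * 1)"
          by (intro tendsto_intros cutoff_tendsto)
        then show ?thesis using True by (simp add: truncated_power_def W_def)
      qed (use neg[of "snd p" "fst p"] in \<open>simp add: W_def\<close>)
    qed
  qed measurable
  moreover have "(LINT p|(lborel \<Otimes>\<^sub>M lborel). W p) = (LINT t|lborel. b t * G t powr (- s - 1)) * mellin \<Theta> s"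
  proof -
    have "integrable (lborel \<Otimes>\<^sub>M lborel) W"
    proof (rule Bochner_Integration.integrable_bound[OF D_int])
      have "norm (W p) \<le> norm (D p)" for p
        using dom[of "snd p" "snd p powr s" "fst p"] powr_le_one_plus[of "snd p" s] s by (simp add: W_def)
      then show "AE p in (lborel \<Otimes>\<^sub>M lborel). norm (W p) \<le> norm (D p)" by simp
    qed measurable
    then have "(LINT p|(lborel \<Otimes>\<^sub>M lborel). W p) = (LINT t|lborel. LINT x|lborel. W (t, x))"
      by (rule lborel_pair.integral_fst'[symmetric])
    also have "\<dots> = (LINT t|lborel. (b t * G t powr (- s - 1)) * mellin \<Theta> s)"
    proof (rule Bochner_Integration.integral_cong)
      fix t
      have "(LINT x|lborel. W (t, x)) = (LINT x|lborel. b t * (x powr s * \<Theta> (x * G t)))"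
        by (simp add: W_def mult_ac)
      also have "\<dots> = b t * (G t powr (- s - 1) * mellin \<Theta> s)"
        by (simp only: integral_mult_right_zero mellin_dilation[OF \<Theta> G])
      finally show "(LINT x|lborel. W (t, x)) = (b t * G t powr (- s - 1)) * mellin \<Theta> s" by simp
    qed simp
    finally show ?thesis by simp
  qed
  ultimately show ?thesis by (simp add: lborel_prod)
qed

lemma continuous_compact_support_integrable:
  fixes h :: "real \<Rightarrow> real"
  assumes "continuous_on {a..b} h" "\<And>x. x \<notin> {a..b} \<Longrightarrow> h x = 0"
  shows "integrable lborel h"
proof -
  have "(\<lambda>x. indicator {a..b} x *\<^sub>R h x) = h"
    using assms(2) by (auto simp: indicator_def fun_eq_iff)
  then show ?thesis
    using borel_integrable_atLeastAtMost'[OF assms(1)] by (simp add: set_integrable_def)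
qed

text \<open>
  Testing with \<open>\<alpha>(t)\<close> times a truncated power and removing the truncation gives, in integrated form,
  the ordinary differential equation \<open>m' + m = K(s) m\<close> for \<open>m = f g powr (- s - 1) M(s)\<close>, the Mellin
  transform in \<open>x\<close> of the self-similar function at time \<open>t\<close>.
\<close>

lemma self_similar_weak_form:
  fixes f g \<Phi> \<alpha> \<alpha>' :: "real \<Rightarrow> real"
  defines "\<Psi> \<equiv> (\<lambda>x. if 0 < x then \<Phi> x else 0)"
  assumes k0: "fragmentation_kernel k0"
    and f: "continuous_on {0<..} f" and g: "continuous_on {0<..} g" "\<And>t. 0 < t \<Longrightarrow> 0 < g t"
    and \<Psi>: "profile \<Psi>"
    and sol: "frag_solution k0 (\<lambda>t x. f t * \<Phi> (x * g t))"
    and \<alpha>: "\<And>t. (\<alpha> has_real_derivative \<alpha>' t) (at t)" "continuous_on UNIV \<alpha>'"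
    and supp: "0 < a" "\<And>t. t \<notin> {a..b} \<Longrightarrow> \<alpha> t = 0" "\<And>t. t \<notin> {a..b} \<Longrightarrow> \<alpha>' t = 0"
    and s: "0 \<le> s" "s \<le> 1"
  shows "(LINT t|lborel. (\<alpha> t - \<alpha>' t) * f t * g t powr (- s - 1)) * mellin \<Psi> s
    = (LINT t|lborel. \<alpha> t * f t * g t powr (- s - 1)) * (kernel_moment k0 s * mellin \<Psi> s)"
proof -
  \<comment> \<open>The value \<open>1\<close> at \<open>t \<le> 0\<close> makes the scaling factor positive and measurable on the whole line.\<close>
  define G where "G = (\<lambda>t. if t \<in> {0<..} then g t else 1)"
  have G_pos: "0 < G t" for t using g(2) by (simp add: G_def)
  have [measurable]: "G \<in> borel_measurable borel"
    unfolding G_def by (rule borel_measurable_continuous_on_if) (use g(1) in auto)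
  have limit: "(\<lambda>n. LINT p|lborel. (c (fst p) * f (fst p)) * \<Theta> (snd p * G (fst p)) * truncated_power s n (snd p))
     \<longlonglongrightarrow> (LINT t|lborel. c t * f t * g t powr (- s - 1)) * mellin \<Theta> s"
    if \<Theta>: "profile \<Theta>" and c: "continuous_on UNIV c" "\<And>t. t \<notin> {a..b} \<Longrightarrow> c t = 0" for \<Theta> c
  proof -
    have sub: "{a..b} \<subseteq> {0<..}" using supp(1) by auto
    have cont: "continuous_on {a..b} c" "continuous_on {a..b} f" "continuous_on {a..b} g"
      using c(1) f g(1) sub by (auto intro: continuous_on_subset)
    have Gg: "G t = g t" and gne: "g t \<noteq> 0" if "t \<in> {a..b}" for t
      using that supp(1) g(2)[of t] by (auto simp: G_def)
    have contG: "continuous_on {a..b} G"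
      using cont(3) by (rule continuous_on_eq) (simp add: Gg)
    have Gne: "G t \<noteq> 0" for t using G_pos[of t] by simp
    have "integrable lborel (\<lambda>t. c t * f t)"
      by (rule continuous_compact_support_integrable[of a b]) (use cont c(2) in \<open>auto intro!: continuous_intros\<close>)
    then have [measurable]: "(\<lambda>t. c t * f t) \<in> borel_measurable borel"
      by (auto dest: borel_measurable_integrable)
    have int: "integrable lborel (\<lambda>t. (c t * f t) / G t)" "integrable lborel (\<lambda>t. (c t * f t) / (G t)\<^sup>2)"
      by (rule continuous_compact_support_integrable[of a b];
          use cont contG Gne c(2) in \<open>auto intro!: continuous_intros\<close>)+
    have "(\<lambda>t. c t * f t * G t powr (- s - 1)) = (\<lambda>t. c t * f t * g t powr (- s - 1))"
    proof
      fix t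
      show "c t * f t * G t powr (- s - 1) = c t * f t * g t powr (- s - 1)"
        using c(2)[of t] Gg[of t] by (cases "t \<in> {a..b}") auto
    qed
    then show ?thesis
      using scaled_profile_limit[OF \<Theta> s _ _ G_pos int] by simp
  qed
  have cont_\<alpha>: "continuous_on UNIV \<alpha>"
    using DERIV_isCont[OF \<alpha>(1)] by (simp add: continuous_at_imp_continuous_on)
  have weak: "(LINT p|lborel. ((\<alpha> (fst p) - \<alpha>' (fst p)) * f (fst p)) * \<Psi> (snd p * G (fst p)) * truncated_power s n (snd p))
     = (LINT p|lborel. (\<alpha> (fst p) * f (fst p)) * fragment k0 \<Psi> (snd p * G (fst p)) * truncated_power s n (snd p))"
    if n: "0 < n" for n
  proof -
    let ?\<eta> = "truncated_power s n"
    obtain \<eta>' where \<eta>: "\<And>x. (?\<eta> has_real_derivative \<eta>' x) (at x)" "continuous_on UNIV \<eta>'"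
      using truncated_power_C1[OF n, of s] by blast
    have \<eta>_supp: "?\<eta> x = 0" if "x \<notin> {1 / real n..real n}" for x
      using cutoff_support[of x n] n that by (auto simp: truncated_power_def)
    let ?\<phi> = "\<lambda>(t, x). \<alpha> t * ?\<eta> x"
    have "C1_test_function_on ?\<phi> quadrant"
      by (rule product_test_function[OF \<alpha> \<eta> supp(1,2) _ \<eta>_supp]) (use n in simp_all)
    then have eq: "(LINT (t, x):quadrant|lborel. f t * \<Phi> (x * g t) * (?\<phi> (t, x) - deriv (\<lambda>s. ?\<phi> (s, x)) t)) =
        (LINT (t, x):quadrant|lborel. frag_gain k0 (\<lambda>t x. f t * \<Phi> (x * g t)) t x * ?\<phi> (t, x))"
      using sol unfolding frag_solution_def by blast
    have deriv: "deriv (\<lambda>s. \<alpha> s * ?\<eta> x) t = \<alpha>' t * ?\<eta> x" for t x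
      by (intro DERIV_imp_deriv) (auto intro!: derivative_eq_intros \<alpha>(1))
    have off: "\<alpha> t = 0" "\<alpha>' t = 0" if "t \<le> 0" for t
      using supp that by auto
    have off_\<eta>: "?\<eta> x = 0" if "x \<le> 0" for x
      using that by (simp add: truncated_power_def)
    have lhs: "indicator quadrant p *\<^sub>R (case p of (t, x) \<Rightarrow> f t * \<Phi> (x * g t) * (?\<phi> (t, x) - deriv (\<lambda>s. ?\<phi> (s, x)) t))
        = ((\<alpha> (fst p) - \<alpha>' (fst p)) * f (fst p)) * \<Psi> (snd p * G (fst p)) * ?\<eta> (snd p)" for p
    proof (cases p)
      case (Pair t x)
      consider "t \<le> 0" | "x \<le> 0" | "0 < t" "0 < x" by linarith
      then show ?thesis
        unfolding Pair using off[of t] off_\<eta>[of x] g(2)[of t]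
        by cases (auto simp: quadrant_def deriv \<Psi>_def G_def algebra_simps)
    qed
    have rhs: "indicator quadrant p *\<^sub>R (case p of (t, x) \<Rightarrow> frag_gain k0 (\<lambda>t x. f t * \<Phi> (x * g t)) t x * ?\<phi> (t, x))
        = (\<alpha> (fst p) * f (fst p)) * fragment k0 \<Psi> (snd p * G (fst p)) * ?\<eta> (snd p)" for p
    proof (cases p)
      case (Pair t x)
      have gain: "frag_gain k0 (\<lambda>t x. f t * \<Phi> (x * g t)) t x = f t * fragment k0 \<Psi> (x * g t)"
        if "0 < t" "0 < x"
      proof -
        have "indicator {0<..1} z *\<^sub>R (f t * \<Phi> (x / z * g t) / z)
          = f t * (indicator {0<..1} z *\<^sub>R (\<Psi> (x * g t / z) / z))" for z
          using that g(2)[of t] by (auto simp: \<Psi>_def indicator_def)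
        then show ?thesis
          unfolding frag_gain_def fragment_def set_lebesgue_integral_def
          by (simp only: integral_mult_right_zero)
      qed
      consider "t \<le> 0" | "x \<le> 0" | "0 < t" "0 < x" by linarith
      then show ?thesis
        unfolding Pair using off[of t] off_\<eta>[of x] gain
        by cases (auto simp: quadrant_def G_def)
    qed
    show ?thesis
      using eq unfolding set_lebesgue_integral_def lhs rhs .
  qed
  have "(\<lambda>n. LINT p|lborel. (\<alpha> (fst p) * f (fst p)) * fragment k0 \<Psi> (snd p * G (fst p)) * truncated_power s n (snd p))
     \<longlonglongrightarrow> (LINT t|lborel. (\<alpha> t - \<alpha>' t) * f t * g t powr (- s - 1)) * mellin \<Psi> s"
  proof (rule Lim_transform_eventually[OF limit[OF \<Psi>, of "\<lambda>t. \<alpha> t - \<alpha>' t"]])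
    show "\<forall>\<^sub>F n in sequentially. (LINT p|lborel. ((\<alpha> (fst p) - \<alpha>' (fst p)) * f (fst p)) * \<Psi> (snd p * G (fst p)) * truncated_power s n (snd p))
     = (LINT p|lborel. (\<alpha> (fst p) * f (fst p)) * fragment k0 \<Psi> (snd p * G (fst p)) * truncated_power s n (snd p))"
      using eventually_gt_at_top[of 0] by eventually_elim (rule weak)
    show "continuous_on UNIV (\<lambda>t. \<alpha> t - \<alpha>' t)" using cont_\<alpha> \<alpha>(2) by (rule continuous_on_diff)
  qed (use supp in auto)
  from LIMSEQ_unique[OF this limit[OF fragment_profile(1)[OF k0 \<Psi>] cont_\<alpha> supp(2)]]
  show ?thesis
    by (simp add: fragment_profile(2)[OF k0 \<Psi> s])
qed

section \<open>Self-similar solutions force affine moments\<close>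

definition bump :: "real \<Rightarrow> real" where
  "bump t = pos_square ((t - 1) * (2 - t))"

definition bump_deriv :: "real \<Rightarrow> real" where
  "bump_deriv t = 2 * max 0 ((t - 1) * (2 - t)) * (3 - 2 * t)"

lemma bump_has_derivative: "(bump has_real_derivative bump_deriv t) (at t)"
  unfolding bump_def[abs_def] bump_deriv_def
  by (auto intro!: derivative_eq_intros)

lemma bump_deriv_continuous: "continuous_on S bump_deriv"
  unfolding bump_deriv_def[abs_def] by (intro continuous_intros)

lemma bump_continuous: "continuous_on S bump"
  unfolding bump_def[abs_def] pos_square_def by (intro continuous_intros)

lemma bump_support:
  assumes "t \<notin> {1..2}"
  shows "bump t = 0" "bump_deriv t = 0"
proof -
  have "(t - 1) * (2 - t) \<le> 0" using assms by (auto simp: mult_le_0_iff)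
  then show "bump t = 0" "bump_deriv t = 0"
    by (simp_all add: bump_def bump_deriv_def pos_square_def)
qed

lemma bump_integral_pos: "0 < (LINT t|lborel. bump t)"
proof -
  \<comment> \<open>With \<open>u = t - 1\<close> this is a primitive of \<open>u\<^sup>2 (1 - u)\<^sup>2\<close>.\<close>
  let ?P = "\<lambda>t::real. (t - 1) ^ 3 / 3 - (t - 1) ^ 4 / 2 + (t - 1) ^ 5 / 5"
  have "bump t = ((t - 1) * (2 - t))\<^sup>2 * indicator {1..2} t" for t
    using bump_support(1)[of t] by (cases "t \<in> {1..2}") (auto simp: bump_def pos_square_def)
  then have "(LINT t|lborel. bump t) = (LINT t|lborel. ((t - 1) * (2 - t))\<^sup>2 * indicator {1..2} t)"
    by (simp only:)
  also have "\<dots> = ?P 2 - ?P 1"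
  proof (rule integral_FTC_Icc_real)
    have eq: "((t - 1) * (2 - t))\<^sup>2 = (t - 1)\<^sup>2 - 2 * (t - 1) ^ 3 + (t - 1) ^ 4" for t :: real
      by algebra
    show "(?P has_real_derivative ((t - 1) * (2 - t))\<^sup>2) (at t)" for t
      unfolding eq by (auto intro!: derivative_eq_intros)
  qed auto
  finally show ?thesis by simp
qed

lemma bump_deriv_integral: "(LINT t|lborel. bump_deriv t) = 0"
proof -
  have "(LINT t|lborel. bump_deriv t) = (LINT t|lborel. bump_deriv t * indicator {1..2} t)"
    using bump_support(2) by (intro Bochner_Integration.integral_cong) (auto simp: indicator_def)
  also have "\<dots> = bump 2 - bump 1"
    using bump_has_derivative continuous_on_eq_continuous_at[of UNIV bump_deriv] bump_deriv_continuous
    by (intro integral_FTC_Icc_real) auto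
  also have "\<dots> = 0" by (simp add: bump_def)
  finally show ?thesis .
qed

text \<open>
  Where \<open>M(s) \<noteq> 0\<close> the equation for \<open>h = f g powr (- s - 1)\<close> is \<open>h'/h = K(s) - 1\<close>, and
  \<open>h'/h = f'/f - (s + 1) g'/g\<close> is affine in \<open>s\<close>.  To read this off from the weak form, the test
  function in time is taken to be \<open>\<beta>/h\<close> with a fixed bump \<open>\<beta>\<close>: then \<open>h\<close> cancels, the integral of \<open>\<beta>'\<close>
  vanishes, and what is left is the average of the equation against \<open>\<beta>\<close>, whose coefficients are
  the same for all \<open>s\<close>.
\<close>

lemma moment_affine_of_self_similar:
  fixes f g f' g' \<Phi> :: "real \<Rightarrow> real"
  defines "\<Psi> \<equiv> (\<lambda>x. if 0 < x then \<Phi> x else 0)"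
  assumes k0: "fragmentation_kernel k0"
    and f: "\<And>t. 0 < t \<Longrightarrow> (f has_real_derivative f' t) (at t)" "continuous_on {0<..} f'" "\<And>t. 0 < t \<Longrightarrow> 0 < f t"
    and g: "\<And>t. 0 < t \<Longrightarrow> (g has_real_derivative g' t) (at t)" "continuous_on {0<..} g'" "\<And>t. 0 < t \<Longrightarrow> 0 < g t"
    and \<Psi>: "profile \<Psi>"
    and sol: "frag_solution k0 (\<lambda>t x. f t * \<Phi> (x * g t))"
  shows "\<exists>A B. \<forall>s\<in>{0..1}. mellin \<Psi> s \<noteq> 0 \<longrightarrow> kernel_moment k0 s = A + B * s"
proof -
  define m where "m = (LINT t|lborel. bump t)"
  define p where "p = (LINT t|lborel. bump t * (f' t / f t))"
  define q where "q = (LINT t|lborel. bump t * (g' t / g t))"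
  have m: "0 < m" unfolding m_def by (rule bump_integral_pos)
  have cont: "continuous_on {0<..} f" "continuous_on {0<..} g"
    using DERIV_isCont[OF f(1)] DERIV_isCont[OF g(1)] by (auto intro!: continuous_at_imp_continuous_on)
  have ne: "f t \<noteq> 0" "g t \<noteq> 0" if "0 < t" for t using f(3)[OF that] g(3)[OF that] by auto
  have sub: "{1..2} \<subseteq> {0::real<..}" by auto
  have int: "integrable lborel bump" "integrable lborel bump_deriv"
      "integrable lborel (\<lambda>t. bump t * (f' t / f t))" "integrable lborel (\<lambda>t. bump t * (g' t / g t))"
    using bump_support ne continuous_on_subset[OF cont(1) sub] continuous_on_subset[OF cont(2) sub]
       continuous_on_subset[OF f(2) sub] continuous_on_subset[OF g(2) sub]
    by (auto intro!: continuous_compact_support_integrable[of 1 2] continuous_intros bump_continuous bump_deriv_continuous)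
  have "kernel_moment k0 s = (1 + (p - q) / m) + (- q / m) * s" if s: "s \<in> {0..1}" and M: "mellin \<Psi> s \<noteq> 0" for s
  proof -
    define h where "h = (\<lambda>t. f t * g t powr (- s - 1))"
    define r where "r = (\<lambda>t. f' t / f t - (s + 1) * (g' t / g t))"
    have h_pos: "0 < h t" if "0 < t" for t
      using f(3)[OF that] g(3)[OF that] by (simp add: h_def)
    have h_deriv: "(h has_real_derivative h t * r t) (at t)" if "0 < t" for t
    proof -
      have "(h has_real_derivative f t * ((- s - 1) * g t powr (- s - 1 - 1) * g' t) + f' t * g t powr (- s - 1)) (at t)"
        unfolding h_def
        by (rule DERIV_mult'[OF f(1)[OF that] DERIV_chain2[OF has_real_derivative_powr[OF g(3)[OF that]] g(1)[OF that]]])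
      moreover have "g t powr (- s - 1 - 1) = g t powr (- s - 1) / g t"
        using g(3)[OF that] powr_diff[of "g t" "- s - 1" 1] by simp
      moreover have "f t * ((- s - 1) * (P / g t) * g' t) + f' t * P = f t * P * r t" for P
        using ne[OF that] by (simp add: r_def field_simps)
      ultimately show ?thesis
        by (simp only: h_def)
    qed
    have h_cont: "continuous_on {0<..} h"
      using cont ne unfolding h_def by (intro continuous_intros) auto
    have r_cont: "continuous_on {0<..} r"
      using cont f(2) g(2) ne unfolding r_def by (intro continuous_intros) auto
    let ?\<alpha>' = "\<lambda>t. (bump_deriv t - bump t * r t) / h t"
    have D: "((\<lambda>t. bump t / h t) has_real_derivative ?\<alpha>' t) (at t)" if "0 < t" for t
    proof -
      have "h t \<noteq> 0" using h_pos[OF that] by simp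
      moreover from this have "(bump_deriv t * h t - bump t * (h t * r t)) / (h t * h t) = ?\<alpha>' t"
        by (simp add: field_simps)
      ultimately show ?thesis
        using DERIV_divide[OF bump_has_derivative h_deriv[OF that]] by simp
    qed
    have C: "continuous_on {0<..} ?\<alpha>'"
      using h_cont r_cont h_pos by (intro continuous_intros bump_continuous bump_deriv_continuous) force+
    have zero: "bump t / h t = 0" if "0 < t" "t < 1" for t
      using that by (simp add: bump_support)
    let ?\<alpha> = "\<lambda>t. if 0 < t then bump t / h t else 0"
    let ?\<alpha>'' = "\<lambda>t. if 0 < t then ?\<alpha>' t else 0"
    have weak: "(LINT t|lborel. (?\<alpha> t - ?\<alpha>'' t) * f t * g t powr (- s - 1)) * mellin \<Psi> s
      = (LINT t|lborel. ?\<alpha> t * f t * g t powr (- s - 1)) * (kernel_moment k0 s * mellin \<Psi> s)"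
      unfolding \<Psi>_def
    proof (rule self_similar_weak_form[OF k0 cont g(3) \<Psi>[unfolded \<Psi>_def] sol, where a = 1 and b = 2])
      show "(?\<alpha> has_real_derivative ?\<alpha>'' t) (at t)" for t
        by (rule zero_extension_C1(1)[OF zero_less_one D C zero])
      show "continuous_on UNIV ?\<alpha>''"
        by (rule zero_extension_C1(2)[OF zero_less_one D C zero])
    qed (use s bump_support in auto)
    have "(?\<alpha> t - ?\<alpha>'' t) * f t * g t powr (- s - 1)
        = bump t - bump_deriv t + bump t * (f' t / f t) - (s + 1) * (bump t * (g' t / g t))" for t
    proof (cases "0 < t")
      case True
      have "(?\<alpha> t - ?\<alpha>'' t) * f t * g t powr (- s - 1) = (bump t / h t - ?\<alpha>' t) * h t"
        using True by (simp add: h_def)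
      also have "\<dots> = bump t - (bump_deriv t - bump t * r t)"
        using h_pos[OF True] by (simp add: field_simps)
      finally show ?thesis by (simp add: r_def algebra_simps)
    next
      case False
      then show ?thesis using bump_support[of t] by simp
    qed
    then have "(LINT t|lborel. (?\<alpha> t - ?\<alpha>'' t) * f t * g t powr (- s - 1))
        = (LINT t|lborel. bump t - bump_deriv t + bump t * (f' t / f t) - (s + 1) * (bump t * (g' t / g t)))"
      by (simp only:)
    also have "\<dots> = m + p - (s + 1) * q"
    proof -
      have "(LINT t|lborel. bump t - bump_deriv t + u t - c * v t)
          = (LINT t|lborel. bump t) - 0 + (LINT t|lborel. u t) - c * (LINT t|lborel. v t)"
        if "integrable lborel u" "integrable lborel v" for u v :: "real \<Rightarrow> real" and c
        using int(1,2) that by (simp add: bump_deriv_integral)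
      from this[OF int(3,4)] show ?thesis by (simp add: m_def p_def q_def)
    qed
    finally have lhs: "(LINT t|lborel. (?\<alpha> t - ?\<alpha>'' t) * f t * g t powr (- s - 1)) = m + p - (s + 1) * q" .
    have "?\<alpha> t * f t * g t powr (- s - 1) = bump t" for t
      using bump_support(1)[of t] h_pos[of t] by (cases "0 < t") (auto simp: h_def)
    then have rhs: "(LINT t|lborel. ?\<alpha> t * f t * g t powr (- s - 1)) = m"
      by (simp only: m_def)
    have "m + p - (s + 1) * q = m * kernel_moment k0 s"
      using weak M unfolding lhs rhs by simp
    then show ?thesis using m by (simp add: field_simps)
  qed
  then show ?thesis by blast
qed

section \<open>Nonexistence of self-similar solutions\<close>

theorem theorem4p2:
  fixes k0 :: "real measure"
  assumes "fragmentation_kernel k0"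
  shows "\<not> (\<exists>(f :: real \<Rightarrow> real) (g :: real \<Rightarrow> real) (\<Phi> :: real \<Rightarrow> real).
            f \<in> {0<..} \<rightarrow> {0<..} \<and> f C1_differentiable_on {0<..} \<and>
            g \<in> {0<..} \<rightarrow> {0<..} \<and> g C1_differentiable_on {0<..} \<and>
            set_integrable lborel {0<..} (\<lambda>x. (1 + x) * \<Phi> x) \<and>
            \<not> (AE x in lborel. 0 < x \<longrightarrow> \<Phi> x = 0) \<and>
            frag_solution k0 (\<lambda>t x. f t * \<Phi> (x * g t)))"
proof (rule notI, elim exE conjE)
  fix f g \<Phi> :: "real \<Rightarrow> real"
  assume pos: "f \<in> {0<..} \<rightarrow> {0<..}" "g \<in> {0<..} \<rightarrow> {0<..}"
    and C1: "f C1_differentiable_on {0<..}" "g C1_differentiable_on {0<..}"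
    and \<Phi>: "set_integrable lborel {0<..} (\<lambda>x. (1 + x) * \<Phi> x)"
    and nontrivial: "\<not> (AE x in lborel. 0 < x \<longrightarrow> \<Phi> x = 0)"
    and sol: "frag_solution k0 (\<lambda>t x. f t * \<Phi> (x * g t))"
  define \<Psi> where "\<Psi> = (\<lambda>x. if 0 < x then \<Phi> x else 0)"
  have "(\<lambda>x. (1 + x) * \<Psi> x) = (\<lambda>x. indicator {0<..} x *\<^sub>R ((1 + x) * \<Phi> x))"
    by (auto simp: \<Psi>_def indicator_def)
  then have \<Psi>: "profile \<Psi>"
    using \<Phi> by (simp add: profile_def set_integrable_def) (simp add: \<Psi>_def)
  obtain f' g' where deriv:
      "\<And>t. 0 < t \<Longrightarrow> (f has_real_derivative f' t) (at t)" "continuous_on {0<..} f'"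
      "\<And>t. 0 < t \<Longrightarrow> (g has_real_derivative g' t) (at t)" "continuous_on {0<..} g'"
    using C1 unfolding C1_differentiable_on_def has_real_derivative_iff_has_vector_derivative by auto
  obtain A B where affine: "\<And>s. s \<in> {0..1} \<Longrightarrow> mellin \<Psi> s \<noteq> 0 \<Longrightarrow> kernel_moment k0 s = A + B * s"
    using moment_affine_of_self_similar[OF assms deriv(1,2) _ deriv(3,4) _ \<Psi>[unfolded \<Psi>_def] sol] pos
    unfolding \<Psi>_def by blast
  have nonzero: "\<exists>s. a < s \<and> s < b \<and> mellin \<Psi> s \<noteq> 0" if "0 < a" "a < b" "b < 1" for a b
  proof (rule ccontr)
    assume "\<not> ?thesis"
    then have "AE y in lborel. \<Psi> y = 0"
      by (intro mellin_uniqueness[OF \<Psi> that]) auto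
    then have "AE x in lborel. 0 < x \<longrightarrow> \<Phi> x = 0"
      by eventually_elim (auto simp: \<Psi>_def)
    then show False using nontrivial by simp
  qed
  \<comment> \<open>Three points in disjoint subintervals of \<open>(0,1)\<close>: affinity at two points would be no restriction.\<close>
  obtain s1 s2 s3 where
      "1/5 < s1" "s1 < 2/5" "mellin \<Psi> s1 \<noteq> 0"
      "2/5 < s2" "s2 < 3/5" "mellin \<Psi> s2 \<noteq> 0"
      "3/5 < s3" "s3 < 4/5" "mellin \<Psi> s3 \<noteq> 0"
    using nonzero[of "1/5" "2/5"] nonzero[of "2/5" "3/5"] nonzero[of "3/5" "4/5"] by auto
  then show False
    using affine by (intro kernel_moment_not_affine[OF assms, of s1 s2 s3 A B]) auto
qed

end
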